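(* Let $(G_n)_{n\in\mathbb N}$, $G_n=(V_n,E_n)$, be a sequence of finite random simple graphs that locally converges to the unimodular Galton–Watson tree $\mathcal T(P,\rho)$, where the degree distribution $P$ has finite second moment $\sum_k k^2P_k<\infty$ (equivalently $\overline\rho=\sum_k k\rho_k<\infty$). Then almost surely, for all $x>0$, $$\varepsilon_{G_n}(x):= x\frac{\partial}{\partial x}\frac{\log Z_{G_n}(x)}{|V_n|}=\frac{1}{|V_n|}\sum_{v\in V_n}\mathcal R_x(G_n,v)\xrightarrow[n\to\infty]{}\mathbb E[Y(x)],$$ and the function $x\mapsto\mathbb E[Y(x)]$ is analytic on $(0,\infty)$. Here $Y(x)\overset{\mathcal D}{=}\frac{x^2}{x^2+\sum_{i=1}^\Delta X_i}$, where $\Delta\sim P$ is independent of $(X_i)_{i\in\mathbb N}$, the $X_i$ are i.i.d. copies of $X$, and the distribution of $X$ is the unique solution supported in $[0,1]$ of $X\overset{\mathcal D}{=}\frac{x^2}{x^2+\sum_{i=1}^K X_i}$ with $K\sim\rho$ independent of $(X_i)_{i\in\mathbb N}$.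
   Context: Monomer-dimer model: for a finite simple graph $G=(V,E)$ and $x>0$, $Z_G(x)=\sum_D x^{|V|-2|D|}$ over all matchings $D\subseteq E$, $\mu_{G,x}(D)=x^{|V|-2|D|}/Z_G(x)$, and $\mathcal R_x(G,o)$ is the $\mu_{G,x}$-probability that $o$ is not covered by an edge of $D$. $[G,v]_r$ is the subgraph induced by vertices at distance $\le r$ from $v$. Galton–Watson tree $\mathcal T(P,\rho)$ rooted at $o$: the root has $\Delta\sim P$ children, each further vertex has an independent $\rho$-distributed number of children; $\mathcal T(P,\rho,r)$ is the subtree of the first $r$ generations. It is unimodular if $0<\overline P:=\sum_k kP_k<\infty$ and $\rho_k=(k+1)P_{k+1}/\overline P$ for all $k$. The random graphs $G_n$ are defined on a common probability space; $(G_n)$ locally converges to $\mathcal T(P,\rho)$ if for every $r\in\mathbb N$ and every finite rooted tree $(T,o)$ with at most $r$ generations, $\frac{1}{|V_n|}\sum_{v\in V_n}\mathbb 1\big(([G_n,v]_r,v)\cong(T,o)\big)\to\mathbb P\big((\mathcal T(P,\rho,r),o)\cong(T,o)\big)$ almost surely, where $\cong$ is isomorphism of rooted graphs. *)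

theory Defs
  imports "HOL-Probability.Probability"
begin

type_synonym 'a graph = "'a set \<times> 'a set set"

definition verts :: "'a graph \<Rightarrow> 'a set" where "verts G = fst G"
definition edges :: "'a graph \<Rightarrow> 'a set set" where "edges G = snd G"

definition simple_graph :: "'a graph \<Rightarrow> bool" where
  "simple_graph G \<longleftrightarrow> finite (verts G) \<and>
     (\<forall>e\<in>edges G. \<exists>u v. u \<in> verts G \<and> v \<in> verts G \<and> u \<noteq> v \<and> e = {u, v})"

fun rball :: "'a graph \<Rightarrow> 'a \<Rightarrow> nat \<Rightarrow> 'a set" where
  "rball G v 0 = {v}"
| "rball G v (Suc r) = rball G v r \<union> {w \<in> verts G. \<exists>u \<in> rball G v r. {u, w} \<in> edges G}"

definition local_view :: "'a graph \<Rightarrow> 'a \<Rightarrow> nat \<Rightarrow> 'a graph" where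
  "local_view G v r = (rball G v r, {e \<in> edges G. e \<subseteq> rball G v r})"

definition rooted_iso :: "'a graph \<Rightarrow> 'a \<Rightarrow> 'b graph \<Rightarrow> 'b \<Rightarrow> bool" where
  "rooted_iso G o1 H o2 \<longleftrightarrow> (\<exists>f. bij_betw f (verts G) (verts H) \<and> f o1 = o2 \<and>
      (\<forall>u\<in>verts G. \<forall>w\<in>verts G. {u, w} \<in> edges G \<longleftrightarrow> {f u, f w} \<in> edges H))"

datatype ptree = Node "ptree list"

fun height :: "ptree \<Rightarrow> nat" where
  "height (Node cs) = foldr (\<lambda>c m. max (Suc (height c)) m) cs 0"

text \<open>Vertices of a tree are addresses (lists of child indices); the root is [].\<close>
function addrs :: "ptree \<Rightarrow> nat list set" where
  "addrs (Node cs) = insert [] (\<Union>i \<in> {..<length cs}. (\<lambda>a. i # a) ` addrs (cs ! i))"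
  by pat_completeness auto
termination
  by (relation "Wellfounded.measure size") (auto simp: less_Suc_eq_le intro!: size_list_estimation' nth_mem)

definition tree_graph :: "ptree \<Rightarrow> nat list graph" where
  "tree_graph t = (addrs t, {{a, a @ [i]} | a i. a @ [i] \<in> addrs t})"

fun iid_list :: "nat \<Rightarrow> 'a pmf \<Rightarrow> 'a list pmf" where
  "iid_list 0 p = return_pmf []"
| "iid_list (Suc k) p = bind_pmf p (\<lambda>x. map_pmf (\<lambda>xs. x # xs) (iid_list k p))"

fun gw_desc :: "nat pmf \<Rightarrow> nat \<Rightarrow> ptree pmf" where
  "gw_desc \<rho> 0 = return_pmf (Node [])"
| "gw_desc \<rho> (Suc d) = bind_pmf \<rho> (\<lambda>k. map_pmf Node (iid_list k (gw_desc \<rho> d)))"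

fun gw_tree :: "nat pmf \<Rightarrow> nat pmf \<Rightarrow> nat \<Rightarrow> ptree pmf" where
  "gw_tree P \<rho> 0 = return_pmf (Node [])"
| "gw_tree P \<rho> (Suc r) = bind_pmf P (\<lambda>k. map_pmf Node (iid_list k (gw_desc \<rho> r)))"

definition mean_pmf :: "nat pmf \<Rightarrow> real" where
  "mean_pmf P = (\<Sum>k. real k * pmf P k)"

definition unimodular :: "nat pmf \<Rightarrow> nat pmf \<Rightarrow> bool" where
  "unimodular P \<rho> \<longleftrightarrow> summable (\<lambda>k. real k * pmf P k) \<and> 0 < mean_pmf P \<and>
     (\<forall>k. pmf \<rho> k = real (k + 1) * pmf P (k + 1) / mean_pmf P)"

definition locally_converges ::
  "'w measure \<Rightarrow> ('w \<Rightarrow> nat \<Rightarrow> 'v graph) \<Rightarrow> nat pmf \<Rightarrow> nat pmf \<Rightarrow> bool" where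
  "locally_converges M G P \<rho> \<longleftrightarrow>
     (\<forall>r t. height t \<le> r \<longrightarrow>
        (AE \<omega> in M. (\<lambda>n. real (card {v \<in> verts (G \<omega> n).
                        rooted_iso (local_view (G \<omega> n) v r) v (tree_graph t) []})
                      / real (card (verts (G \<omega> n))))
           \<longlonglongrightarrow> measure_pmf.prob (gw_tree P \<rho> r)
                  {s. rooted_iso (tree_graph s) [] (tree_graph t) []}))"

definition matchings :: "'a graph \<Rightarrow> 'a set set set" where
  "matchings G = {D. D \<subseteq> edges G \<and> (\<forall>e1\<in>D. \<forall>e2\<in>D. e1 \<noteq> e2 \<longrightarrow> e1 \<inter> e2 = {})}"

definition Z_md :: "'a graph \<Rightarrow> real \<Rightarrow> real" where
  "Z_md G x = (\<Sum>D\<in>matchings G. x ^ (card (verts G) - 2 * card D))"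

text \<open>R_x(G,o): probability under mu_{G,x} that o is not covered by the matching.\<close>
definition R_md :: "real \<Rightarrow> 'a graph \<Rightarrow> 'a \<Rightarrow> real" where
  "R_md x G w = (\<Sum>D\<in>{D \<in> matchings G. w \<notin> \<Union>D}. x ^ (card (verts G) - 2 * card D)) / Z_md G x"

definition eps_md :: "'a graph \<Rightarrow> real \<Rightarrow> real" where
  "eps_md G x = (\<Sum>v\<in>verts G. R_md x G v) / real (card (verts G))"

definition rde_map :: "nat pmf \<Rightarrow> real \<Rightarrow> real measure \<Rightarrow> real measure" where
  "rde_map D x \<mu> = bind (measure_pmf D)
     (\<lambda>k. distr (PiM {..<k} (\<lambda>_. \<mu>)) borel (\<lambda>X. x\<^sup>2 / (x\<^sup>2 + (\<Sum>i<k. X i))))"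

definition rde_solution :: "nat pmf \<Rightarrow> real \<Rightarrow> real measure \<Rightarrow> bool" where
  "rde_solution \<rho> x \<mu> \<longleftrightarrow> prob_space \<mu> \<and> sets \<mu> = sets borel \<and>
     measure \<mu> {0..1} = 1 \<and> rde_map \<rho> x \<mu> = \<mu>"

definition X_law :: "nat pmf \<Rightarrow> real \<Rightarrow> real measure" where
  "X_law \<rho> x = (THE \<mu>. rde_solution \<rho> x \<mu>)"

definition EY :: "nat pmf \<Rightarrow> nat pmf \<Rightarrow> real \<Rightarrow> real" where
  "EY P \<rho> x = (\<integral>y. y \<partial>(rde_map P x (X_law \<rho> x)))"

definition real_analytic_on :: "(real \<Rightarrow> real) \<Rightarrow> real set \<Rightarrow> bool" where
  "real_analytic_on f S \<longleftrightarrow> (\<forall>x0\<in>S. \<exists>r>0. \<exists>a :: nat \<Rightarrow> real.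
      \<forall>x. \<bar>x - x0\<bar> < r \<longrightarrow> (\<lambda>n. a n * (x - x0) ^ n) sums f x)"

end

theory Submission
  imports Defs "HOL-Complex_Analysis.Great_Picard"
begin

text \<open>
  Removing a vertex gives the cavity recursion
  \<open>R_md x G v = x\<^sup>2 / (x\<^sup>2 + \<Sum>w. R_md x (G - v) w)\<close> over the neighbours \<open>w\<close> of \<open>v\<close>. Its right-hand
  side is antitone, so cutting it off at depth \<open>r\<close> gives upper bounds for even \<open>r\<close> and lower bounds
  for odd \<open>r\<close> which depend only on the view of radius \<open>r\<close>. Hence \<open>eps_md\<close> is asymptotically enclosed
  by the expectations of the truncated recursions on the Galton--Watson tree.

  These enclosing bounds meet because of unimodularity. If \<open>\<mu>\<^sub>r\<close> is the law of the recursion at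
  depth \<open>r\<close>, then counting covered edges instead of covered vertices gives
  \<open>1 - E Y\<^sub>r = mean P * E (a b / (x\<^sup>2 + a b))\<close> with independent \<open>a\<close> and \<open>b\<close> of laws \<open>\<mu>\<^sub>r\<close>
  and \<open>\<mu>\<^bsub>r+1\<^esub>\<close>. The right-hand side is symmetric in the two laws, so passing from \<open>r\<close> to \<open>r + 1\<close>
  only replaces \<open>\<mu>\<^sub>r\<close> by \<open>\<mu>\<^bsub>r+2\<^esub>\<close>, and these are consecutive members of a stochastically monotone
  sequence. The same estimate yields existence and uniqueness of the distributional fixed point.

  Analyticity follows from Montel's theorem: at complex activity the recursion preserves the right
  half plane and is bounded there locally uniformly in the tree.
\<close>

section \<open>The cavity recursion on graphs and trees\<close>

definition nbrs :: "'a graph \<Rightarrow> 'a \<Rightarrow> 'a set" where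
  "nbrs G v = {w. {v, w} \<in> edges G}"

definition del_vert :: "'a graph \<Rightarrow> 'a \<Rightarrow> 'a graph" where
  "del_vert G v = (verts G - {v}, {e \<in> edges G. v \<notin> e})"

lemma verts_del_vert [simp]: "verts (del_vert G v) = verts G - {v}"
  and edges_del_vert [simp]: "edges (del_vert G v) = {e \<in> edges G. v \<notin> e}"
  by (simp_all add: del_vert_def verts_def edges_def)

lemma simple_graph_edgeE:
  assumes "simple_graph G" "e \<in> edges G"
  obtains u v where "u \<in> verts G" "v \<in> verts G" "u \<noteq> v" "e = {u, v}"
  using assms unfolding simple_graph_def by metis

lemma simple_graph_edgeD:
  assumes "simple_graph G" "{v, w} \<in> edges G"
  shows "v \<in> verts G" "w \<in> verts G" "v \<noteq> w"
  using assms unfolding simple_graph_def by (force simp: doubleton_eq_iff)+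

lemma simple_graph_finite:
  assumes "simple_graph G"
  shows "finite (verts G)" "finite (edges G)" "finite (matchings G)" "finite (nbrs G v)"
proof -
  show fv: "finite (verts G)" using assms by (simp add: simple_graph_def)
  have "edges G \<subseteq> Pow (verts G)"
    by (auto elim!: simple_graph_edgeE[OF assms])
  then show fe: "finite (edges G)"
    using fv by (meson finite_Pow_iff finite_subset)
  have "matchings G \<subseteq> Pow (edges G)" by (auto simp: matchings_def)
  then show "finite (matchings G)"
    using fe by (meson finite_Pow_iff finite_subset)
  have "nbrs G v \<subseteq> verts G"
    using simple_graph_edgeD[OF assms] by (auto simp: nbrs_def)
  then show "finite (nbrs G v)" using fv finite_subset by blast
qed

lemma simple_graph_del_vert: "simple_graph G \<Longrightarrow> simple_graph (del_vert G v)"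
  unfolding simple_graph_def by fastforce

lemma nbrs_verts: "simple_graph G \<Longrightarrow> nbrs G v \<subseteq> verts G - {v}"
  using simple_graph_edgeD(2,3)[of G v] unfolding nbrs_def by blast

lemma matching_card:
  assumes G: "simple_graph G" and D: "D \<in> matchings G"
  shows "card (\<Union>D) = 2 * card D" "\<Union>D \<subseteq> verts G" "2 * card D \<le> card (verts G)"
proof -
  have e: "card e = 2 \<and> e \<subseteq> verts G \<and> finite e" if "e \<in> D" for e
  proof -
    have "e \<in> edges G" using that D by (auto simp: matchings_def)
    then show ?thesis by (rule simple_graph_edgeE[OF G]) auto
  qed
  have "card (\<Union>D) = (\<Sum>e\<in>D. card e)"
    by (rule card_Union_disjoint) (use D e in \<open>auto simp: matchings_def pairwise_def disjnt_def\<close>)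
  also have "\<dots> = 2 * card D" using e by simp
  finally show c: "card (\<Union>D) = 2 * card D" .
  show s: "\<Union>D \<subseteq> verts G" using e by blast
  show "2 * card D \<le> card (verts G)"
    using card_mono[OF simple_graph_finite(1)[OF G] s] c by simp
qed

lemma matchings_del_vert: "matchings (del_vert G v) = {D \<in> matchings G. v \<notin> \<Union>D}"
  by (auto simp: matchings_def)

lemma Z_md_pos:
  assumes "simple_graph G" "x > 0"
  shows "Z_md G x > 0"
proof -
  have "{} \<in> matchings G" by (auto simp: matchings_def)
  then show ?thesis
    unfolding Z_md_def using assms simple_graph_finite(3)[OF assms(1)]
    by (intro sum_pos) auto
qed

text \<open>The matchings of \<open>G\<close> that leave \<open>v\<close> uncovered are exactly the
  matchings of \<open>del_vert G v\<close>. The lost vertex accounts for one factor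
  \<open>x\<close>; the subtraction in the exponent does not truncate, because a matching of the
  smaller graph covers at most its own vertices.\<close>

lemma unmatched_weight:
  assumes G: "simple_graph G" and v: "v \<in> verts G"
  shows "(\<Sum>D\<in>{D \<in> matchings G. v \<notin> \<Union>D}. x ^ (card (verts G) - 2 * card D))
         = x * Z_md (del_vert G v) x"
proof -
  have "x ^ (card (verts G) - 2 * card D) = x * x ^ (card (verts G - {v}) - 2 * card D)"
    if "D \<in> matchings (del_vert G v)" for D
  proof -
    have "2 * card D \<le> card (verts G - {v})"
      using matching_card(3)[OF simple_graph_del_vert[OF G] that] by simp
    moreover have "card (verts G) = Suc (card (verts G - {v}))"
      using v simple_graph_finite(1)[OF G] by (metis card.remove)
    ultimately show ?thesis by (simp add: Suc_diff_le)
  qed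
  then show ?thesis
    by (simp add: Z_md_def sum_distrib_left matchings_del_vert)
qed

lemma R_md_eq:
  assumes "simple_graph G" "v \<in> verts G"
  shows "R_md x G v = x * Z_md (del_vert G v) x / Z_md G x"
  unfolding R_md_def unmatched_weight[OF assms] ..

text \<open>The edge covering \<open>v\<close> determines its other endpoint \<open>w\<close>. What
  remains of the matching touches neither endpoint, so it lives on the graph with both
  deleted.\<close>

lemma matched_matchings:
  assumes G: "simple_graph G"
  shows "{D \<in> matchings G. v \<in> \<Union>D}
       = (\<Union>w\<in>nbrs G v. insert {v, w} ` matchings (del_vert (del_vert G v) w))"
proof (intro equalityI subsetI)
  fix D assume "D \<in> {D \<in> matchings G. v \<in> \<Union>D}"
  then obtain e where D: "D \<in> matchings G" and e: "e \<in> D" "v \<in> e" by blast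
  then have "e \<in> edges G" by (auto simp: matchings_def)
  then obtain w where w: "e = {v, w}"
    using e(2) by (elim simple_graph_edgeE[OF G]) auto
  have "e \<inter> e' = {}" if "e' \<in> D - {e}" for e'
    using D e that by (auto simp: matchings_def)
  then have "D - {e} \<in> matchings (del_vert (del_vert G v) w)"
    using D w by (fastforce simp: matchings_def)
  moreover have "D = insert {v, w} (D - {e})" using e w by auto
  ultimately show "D \<in> (\<Union>w\<in>nbrs G v. insert {v, w} ` matchings (del_vert (del_vert G v) w))"
    using w \<open>e \<in> edges G\<close> unfolding nbrs_def by blast
qed (auto simp: nbrs_def matchings_def)

text \<open>Split the matchings by whether \<open>v\<close> is covered, and by which neighbour.
  Removing an edge together with both of its endpoints leaves the exponent unchanged, so the
  neighbour terms carry no power of \<open>x\<close>.\<close>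

lemma Z_md_rec:
  assumes G: "simple_graph G" and v: "v \<in> verts G"
  shows "Z_md G x = x * Z_md (del_vert G v) x
                    + (\<Sum>w\<in>nbrs G v. Z_md (del_vert (del_vert G v) w) x)"
proof -
  let ?w = "\<lambda>D. x ^ (card (verts G) - 2 * card D)"
  let ?G = "\<lambda>w. del_vert (del_vert G v) w"
  have "{v, w} \<notin> D" if "D \<in> matchings (?G w)" for w D
    using that by (auto simp: matchings_def)
  then have inj: "inj_on (insert {v, w}) (matchings (?G w))" for w
    by (intro inj_onI) (metis insert_ident)
  have edge: "?w (insert {v, w} D) = x ^ (card (verts (?G w)) - 2 * card D)"
    if "w \<in> nbrs G v" "D \<in> matchings (?G w)" for w D
  proof -
    have "w \<in> verts G - {v}" using nbrs_verts[OF G] that by blast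
    then have "card (verts G) = Suc (Suc (card (verts (?G w))))"
      using v simple_graph_finite(1)[OF G]
      by (metis card.remove finite_Diff verts_del_vert)
    moreover have "finite D"
      using simple_graph_finite(2)[OF G] that(2) finite_subset by (fastforce simp: matchings_def)
    then have "card (insert {v, w} D) = Suc (card D)"
      using \<open>D \<in> matchings (?G w) \<Longrightarrow> {v, w} \<notin> D\<close> that by simp
    ultimately show ?thesis by simp
  qed
  have disj: "insert {v, w} ` matchings (?G w) \<inter> insert {v, w'} ` matchings (?G w') = {}"
    if "w \<noteq> w'" for w w'
  proof (rule ccontr)
    assume "\<not> ?thesis"
    then obtain D D' where D: "D' \<in> matchings (?G w')"
      and eq: "insert {v, w} D = insert {v, w'} D'" by blast
    have "{v, w} \<in> insert {v, w'} D'" unfolding eq[symmetric] by simp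
    then have "{v, w} \<in> D'" using that by (auto simp: doubleton_eq_iff)
    with D show False by (auto simp: matchings_def)
  qed
  have "Z_md G x = (\<Sum>D\<in>{D \<in> matchings G. v \<notin> \<Union>D}. ?w D) + (\<Sum>D\<in>{D \<in> matchings G. v \<in> \<Union>D}. ?w D)"
    unfolding Z_md_def using simple_graph_finite(3)[OF G]
    by (subst sum.union_disjoint[symmetric]) (auto intro!: sum.cong)
  also have "(\<Sum>D\<in>{D \<in> matchings G. v \<in> \<Union>D}. ?w D)
      = (\<Sum>w\<in>nbrs G v. \<Sum>D\<in>insert {v, w} ` matchings (?G w). ?w D)"
    unfolding matched_matchings[OF G]
    using simple_graph_finite(4)[OF G] disj
      simple_graph_finite(3)[OF simple_graph_del_vert[OF simple_graph_del_vert[OF G]]]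
    by (intro sum.UNION_disjoint) auto
  also have "\<dots> = (\<Sum>w\<in>nbrs G v. Z_md (?G w) x)"
    by (intro sum.cong refl) (simp add: sum.reindex[OF inj] Z_md_def edge)
  finally show ?thesis unfolding unmatched_weight[OF G v] .
qed

text \<open>Divide \<open>Z_md_rec\<close> by the partition function of \<open>del_vert G v\<close>:
  the neighbour terms become, up to a factor \<open>x\<close>, the ratios that
  \<open>R_md_eq\<close> identifies as probabilities in the smaller graph.\<close>

lemma R_md_rec:
  assumes G: "simple_graph G" and v: "v \<in> verts G" and x: "x > 0"
  shows "R_md x G v = x\<^sup>2 / (x\<^sup>2 + (\<Sum>w\<in>nbrs G v. R_md x (del_vert G v) w))"
proof -
  let ?Z = "Z_md (del_vert G v) x"
  have Z: "?Z > 0" using Z_md_pos[OF simple_graph_del_vert[OF G] x] .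
  have "(\<Sum>w\<in>nbrs G v. R_md x (del_vert G v) w)
      = (\<Sum>w\<in>nbrs G v. x * Z_md (del_vert (del_vert G v) w) x / ?Z)"
    using nbrs_verts[OF G] by (intro sum.cong refl R_md_eq simple_graph_del_vert G) auto
  also have "\<dots> = x * (\<Sum>w\<in>nbrs G v. Z_md (del_vert (del_vert G v) w) x) / ?Z"
    by (simp add: sum_distrib_left sum_divide_distrib)
  also have "\<dots> = x * (Z_md G x - x * ?Z) / ?Z"
    using Z_md_rec[OF G v, of x] by simp
  finally have "x\<^sup>2 + (\<Sum>w\<in>nbrs G v. R_md x (del_vert G v) w) = x * Z_md G x / ?Z"
    using Z by (simp add: field_simps power2_eq_square)
  then show ?thesis
    using R_md_eq[OF G v, of x] Z x Z_md_pos[OF G x] by (simp add: power2_eq_square)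
qed

lemma R_md_nonneg:
  assumes "simple_graph G" "x > 0"
  shows "0 \<le> R_md x G v"
  unfolding R_md_def using assms Z_md_pos[OF assms] by (auto intro!: divide_nonneg_nonneg sum_nonneg)

lemma R_md_le_1:
  assumes "simple_graph G" "x > 0"
  shows "R_md x G v \<le> 1"
  unfolding R_md_def using Z_md_pos[OF assms] assms simple_graph_finite(3)[OF assms(1)]
  by (auto simp: Z_md_def intro!: sum_mono2)

text \<open>Weighting each matching by its number of uncovered vertices is the same as differentiating
  its monomial.\<close>
lemma deriv_ln_Z_md:
  assumes G: "simple_graph G" and x: "x > 0"
  shows "x * deriv (\<lambda>y. ln (Z_md G y) / real (card (verts G))) x = eps_md G x"
proof -
  let ?m = "\<lambda>D. card (verts G) - 2 * card D"
  define Z' where "Z' = (\<Sum>D\<in>matchings G. real (?m D) * x ^ (?m D - 1))"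
  have "(Z_md G has_real_derivative Z') (at x)"
    unfolding Z_md_def[abs_def] Z'_def by (auto intro!: derivative_eq_intros sum.cong)
  then have "((\<lambda>y. ln (Z_md G y) / real (card (verts G))) has_real_derivative
      (1 / Z_md G x * Z') / real (card (verts G))) (at x)"
    using Z_md_pos[OF G x] by (intro DERIV_cdivide DERIV_ln_divide[THEN DERIV_chain2])
  then have d: "x * deriv (\<lambda>y. ln (Z_md G y) / real (card (verts G))) x
      = (x * Z') / Z_md G x / real (card (verts G))"
    by (simp add: DERIV_imp_deriv)
  have "x * Z' = (\<Sum>D\<in>matchings G. real (?m D) * x ^ ?m D)"
    unfolding Z'_def sum_distrib_left
  proof (intro sum.cong refl)
    fix D show "x * (real (?m D) * x ^ (?m D - 1)) = real (?m D) * x ^ ?m D"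
      by (cases "?m D") auto
  qed
  also have "\<dots> = (\<Sum>D\<in>matchings G. \<Sum>v\<in>verts G. if v \<notin> \<Union>D then x ^ ?m D else 0)"
  proof (intro sum.cong refl)
    fix D assume D: "D \<in> matchings G"
    have "(\<Sum>v\<in>verts G. if v \<notin> \<Union>D then x ^ ?m D else 0) = (\<Sum>v\<in>verts G - \<Union>D. x ^ ?m D)"
      by (rule sum.mono_neutral_cong_right) (use simple_graph_finite(1)[OF G] in auto)
    moreover have "card (verts G - \<Union>D) = ?m D"
      using matching_card[OF G D] simple_graph_finite(1)[OF G]
      by (metis card_Diff_subset finite_subset)
    ultimately show "real (?m D) * x ^ ?m D = (\<Sum>v\<in>verts G. if v \<notin> \<Union>D then x ^ ?m D else 0)"
      by simp
  qed
  also have "\<dots> = (\<Sum>v\<in>verts G. \<Sum>D\<in>matchings G. if v \<notin> \<Union>D then x ^ ?m D else 0)"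
    by (rule sum.swap)
  also have "\<dots> = (\<Sum>v\<in>verts G. \<Sum>D\<in>{D\<in>matchings G. v \<notin> \<Union>D}. x ^ ?m D)"
    using simple_graph_finite(3)[OF G] by (intro sum.cong refl sum.inter_filter[symmetric])
  finally show ?thesis
    unfolding d eps_md_def R_md_def by (simp add: sum_divide_distrib[symmetric])
qed

section \<open>Truncated cavity recursions\<close>

fun graph_cavity :: "real \<Rightarrow> nat \<Rightarrow> 'a graph \<Rightarrow> 'a \<Rightarrow> real" where
  "graph_cavity x 0 G v = 1"
| "graph_cavity x (Suc r) G v
     = x\<^sup>2 / (x\<^sup>2 + (\<Sum>w\<in>nbrs G v. graph_cavity x r (del_vert G v) w))"

text \<open>On a tree, deleting the root separates the branches, so vertex deletion becomes passage
  to the subtrees. The cut-off value 1 is the largest value a probability can take, which makes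
  depth 0 an upper bound.\<close>

fun tree_cavity :: "real \<Rightarrow> nat \<Rightarrow> ptree \<Rightarrow> real" where
  "tree_cavity x 0 t = 1"
| "tree_cavity x (Suc r) (Node cs) = x\<^sup>2 / (x\<^sup>2 + (\<Sum>c\<leftarrow>cs. tree_cavity x r c))"

lemma graph_cavity_nonneg: "0 \<le> graph_cavity x r G v"
proof (induction r arbitrary: G v)
  case (Suc r)
  show ?case unfolding graph_cavity.simps
    by (intro divide_nonneg_nonneg add_nonneg_nonneg sum_nonneg Suc.IH zero_le_power2)
qed simp

lemma cavity_fraction_antimono:
  assumes "(x::real) > 0" "0 \<le> s" "s \<le> t"
  shows "x\<^sup>2 / (x\<^sup>2 + t) \<le> x\<^sup>2 / (x\<^sup>2 + s)"
  using assms by (intro divide_left_mono mult_pos_pos add_pos_nonneg) auto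

text \<open>Each level of the recursion reverses the inequality, starting from
  \<open>R_md_le_1\<close>. The induction ranges over all graphs because every level deletes a
  vertex.\<close>

lemma R_md_graph_cavity:
  assumes "simple_graph G" "v \<in> verts G" "x > 0"
  shows "if even r then R_md x G v \<le> graph_cavity x r G v else graph_cavity x r G v \<le> R_md x G v"
  using assms(1,2)
proof (induction r arbitrary: G v)
  case 0
  then show ?case using R_md_le_1[OF 0(1) assms(3)] by simp
next
  case (Suc r)
  have IH: "if even r then R_md x (del_vert G v) w \<le> graph_cavity x r (del_vert G v) w
      else graph_cavity x r (del_vert G v) w \<le> R_md x (del_vert G v) w" if "w \<in> nbrs G v" for w
  proof (rule Suc.IH[OF simple_graph_del_vert[OF Suc.prems(1)]])
    show "w \<in> verts (del_vert G v)"
      using nbrs_verts[OF Suc.prems(1)] that by (metis subsetD verts_del_vert)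
  qed
  let ?R = "\<Sum>w\<in>nbrs G v. R_md x (del_vert G v) w"
  let ?C = "\<Sum>w\<in>nbrs G v. graph_cavity x r (del_vert G v) w"
  have nn: "0 \<le> ?R" "0 \<le> ?C"
    using R_md_nonneg[OF simple_graph_del_vert[OF Suc.prems(1)] assms(3)]
    by (auto intro!: sum_nonneg graph_cavity_nonneg)
  show ?case
  proof (cases "even r")
    case True
    then have "?R \<le> ?C" using IH by (intro sum_mono) auto
    then show ?thesis
      using True cavity_fraction_antimono[OF assms(3) nn(1)] R_md_rec[OF Suc.prems assms(3)] by simp
  next
    case False
    then have "?C \<le> ?R" using IH by (intro sum_mono) auto
    then show ?thesis
      using False cavity_fraction_antimono[OF assms(3) nn(2)] R_md_rec[OF Suc.prems assms(3)] by simp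
  qed
qed

section \<open>Transfer of the recursion from graphs to trees\<close>

lemma Nil_in_addrs [simp]: "[] \<in> addrs t"
  by (cases t) simp

lemma Cons_in_addrs [simp]:
  "i # a \<in> addrs (Node cs) \<longleftrightarrow> i < length cs \<and> a \<in> addrs (cs ! i)"
  by auto

declare addrs.simps [simp del]

lemma addrs_butlast: "a @ [i] \<in> addrs t \<Longrightarrow> a \<in> addrs t"
proof (induction a arbitrary: t)
  case (Cons j a)
  then show ?case by (cases t) auto
qed simp

lemma tree_edge_iff:
  "{a, b} \<in> edges (tree_graph t)
     \<longleftrightarrow> (\<exists>i. b = a @ [i] \<and> b \<in> addrs t) \<or> (\<exists>i. a = b @ [i] \<and> a \<in> addrs t)"
  by (auto simp: tree_graph_def edges_def doubleton_eq_iff)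

lemma verts_tree_graph [simp]: "verts (tree_graph t) = addrs t"
  by (simp add: tree_graph_def verts_def)

text \<open>An induced copy of the tree in \<open>G\<close> which contains every neighbour of its
  vertices at depth below \<open>r\<close>; deeper vertices may have further neighbours. Recursion
  to depth \<open>r\<close> never sees those, and unlike an isomorphism with a ball, this property
  passes to the branches once the root is deleted.\<close>

definition local_embedding :: "'a graph \<Rightarrow> (nat list \<Rightarrow> 'a) \<Rightarrow> ptree \<Rightarrow> nat \<Rightarrow> bool" where
  "local_embedding G f t r \<longleftrightarrow> inj_on f (addrs t) \<and>
     (\<forall>a\<in>addrs t. \<forall>b\<in>addrs t. {f a, f b} \<in> edges G \<longleftrightarrow> {a, b} \<in> edges (tree_graph t)) \<and>
     (\<forall>a\<in>addrs t. length a < r \<longrightarrow> nbrs G (f a) \<subseteq> f ` addrs t)"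

lemma local_embedding_nbrs:
  assumes "local_embedding G f (Node cs) (Suc r)"
  shows "nbrs G (f []) = (\<lambda>i. f [i]) ` {..<length cs}"
proof (intro equalityI subsetI)
  fix w assume w: "w \<in> nbrs G (f [])"
  have "nbrs G (f []) \<subseteq> f ` addrs (Node cs)"
    using assms unfolding local_embedding_def by (metis Nil_in_addrs list.size(3) zero_less_Suc)
  with w obtain b where b: "b \<in> addrs (Node cs)" "w = f b" by blast
  then have "{[], b} \<in> edges (tree_graph (Node cs))"
    using assms w unfolding local_embedding_def by (auto simp: nbrs_def)
  then show "w \<in> (\<lambda>i. f [i]) ` {..<length cs}"
    using b by (auto simp: tree_edge_iff)
next
  fix w assume "w \<in> (\<lambda>i. f [i]) ` {..<length cs}"
  then obtain i where i: "i < length cs" "w = f [i]" by blast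
  then have "[i] \<in> addrs (Node cs)" by simp
  moreover from this have "{[], [i]} \<in> edges (tree_graph (Node cs))" by (auto simp: tree_edge_iff)
  ultimately show "w \<in> nbrs G (f [])"
    using assms i unfolding local_embedding_def nbrs_def by simp
qed

lemma local_embedding_child:
  assumes L: "local_embedding G f (Node cs) (Suc r)" and i: "i < length cs"
  shows "local_embedding (del_vert G (f [])) (\<lambda>a. f (i # a)) (cs ! i) r"
proof -
  let ?t = "Node cs"
  have inj: "inj_on f (addrs ?t)"
    and E: "\<And>a b. a \<in> addrs ?t \<Longrightarrow> b \<in> addrs ?t
              \<Longrightarrow> {f a, f b} \<in> edges G \<longleftrightarrow> {a, b} \<in> edges (tree_graph ?t)"
    and N: "\<And>a. a \<in> addrs ?t \<Longrightarrow> length a < Suc r \<Longrightarrow> nbrs G (f a) \<subseteq> f ` addrs ?t"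
    using L unfolding local_embedding_def by auto
  have root: "f (i # a) \<noteq> f []" if "a \<in> addrs (cs ! i)" for a
    using inj_onD[OF inj, of "i # a" "[]"] that i by auto
  have shift: "{i # a, i # b} \<in> edges (tree_graph ?t) \<longleftrightarrow> {a, b} \<in> edges (tree_graph (cs ! i))" for a b
    using i by (auto simp: tree_edge_iff)
  show ?thesis
    unfolding local_embedding_def
  proof (intro conjI ballI impI)
    show "inj_on (\<lambda>a. f (i # a)) (addrs (cs ! i))"
      using i by (auto intro!: inj_onI dest: inj_onD[OF inj])
    show "{f (i # a), f (i # b)} \<in> edges (del_vert G (f []))
          \<longleftrightarrow> {a, b} \<in> edges (tree_graph (cs ! i))"
      if "a \<in> addrs (cs ! i)" "b \<in> addrs (cs ! i)" for a b
      using E[of "i # a" "i # b"] that i root[OF that(1)] root[OF that(2)] by (auto simp: shift)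
    show "nbrs (del_vert G (f [])) (f (i # a)) \<subseteq> (\<lambda>a. f (i # a)) ` addrs (cs ! i)"
      if a: "a \<in> addrs (cs ! i)" "length a < r" for a
    proof
      fix w assume "w \<in> nbrs (del_vert G (f [])) (f (i # a))"
      then have w: "{f (i # a), w} \<in> edges G" "w \<noteq> f []" by (auto simp: nbrs_def)
      have ia: "i # a \<in> addrs ?t" using a i by simp
      obtain b where b: "b \<in> addrs ?t" "w = f b"
        using N[OF ia] a(2) w(1) by (auto simp: nbrs_def)
      have "{i # a, b} \<in> edges (tree_graph ?t)" using E[OF ia b(1)] w b by simp
      \<comment> \<open>The root is the only gate between different branches, and it has been
        deleted; the neighbour therefore stays in branch \<open>i\<close>.\<close>
      moreover have "b \<noteq> []" using b w by blast
      ultimately obtain b' where "b = i # b'"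
        by (auto simp: tree_edge_iff Cons_eq_append_conv)
      then show "w \<in> (\<lambda>a. f (i # a)) ` addrs (cs ! i)" using b by auto
    qed
  qed
qed

lemma graph_cavity_local_embedding:
  "local_embedding G f t r \<Longrightarrow> graph_cavity x r G (f []) = tree_cavity x r t"
proof (induction r arbitrary: G f t)
  case (Suc r)
  obtain cs where t: "t = Node cs" by (cases t)
  note L = Suc.prems[unfolded t]
  have inj: "inj_on (\<lambda>i. f [i]) {..<length cs}"
    using L unfolding local_embedding_def by (auto intro!: inj_onI dest: inj_onD)
  have "(\<Sum>w\<in>nbrs G (f []). graph_cavity x r (del_vert G (f [])) w)
      = (\<Sum>i<length cs. graph_cavity x r (del_vert G (f [])) (f [i]))"
    unfolding local_embedding_nbrs[OF L] by (simp add: sum.reindex[OF inj])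
  also have "\<dots> = (\<Sum>i<length cs. tree_cavity x r (cs ! i))"
    using Suc.IH[OF local_embedding_child[OF L]] by (intro sum.cong) auto
  also have "\<dots> = (\<Sum>c\<leftarrow>cs. tree_cavity x r c)"
    by (simp add: sum_list_sum_nth atLeast0LessThan)
  finally show ?case by (simp add: t)
qed simp

section \<open>Rooted isomorphisms and local views\<close>

text \<open>The inverse bijection is known to send the root back only if \<open>u\<close> is a
  vertex, which \<open>rooted_iso\<close> itself does not demand; hence the second
  assumption.\<close>

lemma rooted_iso_sym:
  assumes "rooted_iso G u H v" "u \<in> verts G"
  shows "rooted_iso H v G u"
proof -
  obtain f where f: "bij_betw f (verts G) (verts H)" "f u = v"
    and E: "\<And>a b. a \<in> verts G \<Longrightarrow> b \<in> verts G \<Longrightarrow> {a, b} \<in> edges G \<longleftrightarrow> {f a, f b} \<in> edges H"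
    using assms(1) unfolding rooted_iso_def by auto
  let ?g = "the_inv_into (verts G) f"
  have inj: "inj_on f (verts G)" using f(1) by (simp add: bij_betw_def)
  have g: "?g a \<in> verts G \<and> f (?g a) = a" if "a \<in> verts H" for a
    using f_the_inv_into_f_bij_betw[OF f(1)] that bij_betwE[OF bij_betw_the_inv_into[OF f(1)]] by auto
  have "?g v = u" using the_inv_into_f_f[OF inj assms(2)] f(2) by simp
  then show ?thesis
    unfolding rooted_iso_def using bij_betw_the_inv_into[OF f(1)] g E by (intro exI[of _ ?g]) auto
qed

lemma rooted_iso_trans:
  assumes "rooted_iso G u H v" "rooted_iso H v K w"
  shows "rooted_iso G u K w"
proof -
  obtain f where f: "bij_betw f (verts G) (verts H)" "f u = v"
    and E: "\<And>a b. a \<in> verts G \<Longrightarrow> b \<in> verts G \<Longrightarrow> {a, b} \<in> edges G \<longleftrightarrow> {f a, f b} \<in> edges H"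
    using assms(1) unfolding rooted_iso_def by auto
  obtain g where g: "bij_betw g (verts H) (verts K)" "g v = w"
    and E': "\<And>a b. a \<in> verts H \<Longrightarrow> b \<in> verts H \<Longrightarrow> {a, b} \<in> edges H \<longleftrightarrow> {g a, g b} \<in> edges K"
    using assms(2) unfolding rooted_iso_def by auto
  show ?thesis
    unfolding rooted_iso_def
    using bij_betw_trans[OF f(1) g(1)] f(2) g(2) E E' bij_betwE[OF f(1)]
    by (intro exI[of _ "g \<circ> f"]) auto
qed

lemma verts_local_view [simp]: "verts (local_view G v r) = rball G v r"
  and edges_local_view [simp]: "edges (local_view G v r) = {e \<in> edges G. e \<subseteq> rball G v r}"
  by (simp_all add: local_view_def verts_def edges_def)

lemma rball_mono: "r \<le> s \<Longrightarrow> rball G v r \<subseteq> rball G v s"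
  by (induction rule: dec_induct) auto

lemma root_in_rball: "v \<in> rball G v r"
  using rball_mono[of 0 r G v] by auto

lemma local_view_iso_local_embedding:
  assumes G: "simple_graph G" and iso: "rooted_iso (local_view G v r) v (tree_graph t) []"
  obtains f where "local_embedding G f t r" "f [] = v"
proof -
  have "rooted_iso (tree_graph t) [] (local_view G v r) v"
    by (rule rooted_iso_sym[OF iso]) (simp add: root_in_rball)
  then obtain f where f: "bij_betw f (addrs t) (rball G v r)" "f [] = v"
    and E: "\<And>a b. a \<in> addrs t \<Longrightarrow> b \<in> addrs t \<Longrightarrow> {a, b} \<in> edges (tree_graph t)
               \<longleftrightarrow> {f a, f b} \<in> edges G \<and> {f a, f b} \<subseteq> rball G v r"
    unfolding rooted_iso_def by auto
  have im: "f ` addrs t = rball G v r" using f(1) by (simp add: bij_betw_def)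
  have E': "{a, b} \<in> edges (tree_graph t) \<longleftrightarrow> {f a, f b} \<in> edges G"
    if "a \<in> addrs t" "b \<in> addrs t" for a b
    using E[OF that] that im by auto
  \<comment> \<open>A vertex with address \<open>a\<close> is reached from \<open>v\<close> in
    \<open>length a\<close> steps. For \<open>length a < r\<close> all its neighbours then lie in
    the ball of radius \<open>r\<close>, which is the image of the tree.\<close>
  have depth: "a \<in> addrs t \<Longrightarrow> f a \<in> rball G v (length a)" for a
  proof (induction a rule: rev_induct)
    case (snoc i a)
    have a: "a \<in> addrs t" using snoc.prems by (rule addrs_butlast)
    then have "{f a, f (a @ [i])} \<in> edges G"
      using E'[OF a snoc.prems] snoc.prems by (auto simp: tree_edge_iff)
    then show ?case using snoc.IH[OF a] simple_graph_edgeD(2)[OF G] by auto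
  qed (simp add: f)
  have "nbrs G (f a) \<subseteq> f ` addrs t" if "a \<in> addrs t" "length a < r" for a
  proof -
    have "nbrs G (f a) \<subseteq> rball G v (Suc (length a))"
      using depth[OF that(1)] simple_graph_edgeD(2)[OF G] by (auto simp: nbrs_def)
    also have "\<dots> \<subseteq> f ` addrs t"
      unfolding im by (rule rball_mono) (use that in simp)
    finally show ?thesis .
  qed
  then have "local_embedding G f t r"
    using f(1) E' by (auto simp: local_embedding_def bij_betw_def)
  with f(2) show ?thesis by (rule that[rotated])
qed

abbreviation tree_iso :: "ptree \<Rightarrow> ptree \<Rightarrow> bool" where
  "tree_iso s t \<equiv> rooted_iso (tree_graph s) [] (tree_graph t) []"

lemma tree_iso_refl: "tree_iso t t"
  unfolding rooted_iso_def by (intro exI[of _ id]) auto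

lemma tree_iso_sym: "tree_iso s t \<Longrightarrow> tree_iso t s"
  by (erule rooted_iso_sym) simp

lemma tree_iso_local_embedding:
  assumes "tree_iso s t"
  obtains f where "local_embedding (tree_graph t) f s r" "f [] = []"
proof -
  obtain f where f: "bij_betw f (addrs s) (addrs t)" "f [] = []"
    and E: "\<And>a b. a \<in> addrs s \<Longrightarrow> b \<in> addrs s
              \<Longrightarrow> {a, b} \<in> edges (tree_graph s) \<longleftrightarrow> {f a, f b} \<in> edges (tree_graph t)"
    using assms unfolding rooted_iso_def by auto
  have "nbrs (tree_graph t) b \<subseteq> addrs t" for b
    by (auto simp: nbrs_def tree_edge_iff dest: addrs_butlast)
  then have "local_embedding (tree_graph t) f s r"
    using f(1) E by (auto simp: local_embedding_def bij_betw_def)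
  with f(2) show ?thesis by (rule that[rotated])
qed

text \<open>Both trees embed into the same graph \<open>tree_graph t\<close> with the same root, so
  both values equal \<open>graph_cavity\<close> there.\<close>

lemma tree_cavity_iso:
  assumes "tree_iso s t"
  shows "tree_cavity x r s = tree_cavity x r t"
proof -
  obtain g where "local_embedding (tree_graph t) g t r" "g [] = []"
    using tree_iso_local_embedding[OF tree_iso_refl] .
  moreover obtain f where "local_embedding (tree_graph t) f s r" "f [] = []"
    using tree_iso_local_embedding[OF assms] .
  ultimately show ?thesis
    by (metis graph_cavity_local_embedding)
qed

lemma R_md_tree_cavity:
  assumes "simple_graph G" "v \<in> verts G" "x > 0"
    and "rooted_iso (local_view G v r) v (tree_graph t) []"
  shows "if even r then R_md x G v \<le> tree_cavity x r t else tree_cavity x r t \<le> R_md x G v"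
  using R_md_graph_cavity[OF assms(1-3)] local_view_iso_local_embedding[OF assms(1,4)]
  by (metis graph_cavity_local_embedding)

lemma tree_cavity_bounds:
  assumes "x > 0"
  shows "0 < tree_cavity x r t" "tree_cavity x r t \<le> 1"
proof -
  have "0 < tree_cavity x r t \<and> tree_cavity x r t \<le> 1"
  proof (induction r arbitrary: t)
    case (Suc r)
    obtain cs where t: "t = Node cs" by (cases t)
    have "0 \<le> (\<Sum>c\<leftarrow>cs. tree_cavity x r c)"
      using Suc by (intro sum_list_nonneg) (auto intro: less_imp_le)
    then show ?case using assms by (simp add: t add_pos_nonneg divide_le_eq_1)
  qed simp
  then show "0 < tree_cavity x r t" "tree_cavity x r t \<le> 1" by auto
qed

section \<open>Laws on the unit interval and the distributional recursion\<close>

definition unit_law :: "real measure \<Rightarrow> bool" where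
  "unit_law \<mu> \<longleftrightarrow> prob_space \<mu> \<and> sets \<mu> = sets borel \<and> measure \<mu> {0..1} = 1"

lemma unit_lawD:
  assumes "unit_law \<mu>"
  shows "prob_space \<mu>" "sets \<mu> = sets borel" "space \<mu> = UNIV" "AE y in \<mu>. 0 \<le> y \<and> y \<le> 1"
proof -
  show 1: "prob_space \<mu>" "sets \<mu> = sets borel" using assms by (auto simp: unit_law_def)
  show "space \<mu> = UNIV" using sets_eq_imp_space_eq[OF 1(2)] by simp
  have "AE y in \<mu>. y \<in> {0..1}"
    using assms by (intro prob_space.AE_prob_1 1) (simp add: unit_law_def)
  then show "AE y in \<mu>. 0 \<le> y \<and> y \<le> 1" by simp
qed

lemma unit_lawI_AE:
  assumes "prob_space \<mu>" "sets \<mu> = sets borel" "AE y in \<mu>. 0 \<le> y \<and> y \<le> 1"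
  shows "unit_law \<mu>"
proof -
  have "{0..1::real} \<in> sets \<mu>" using assms(2) by simp
  then have "measure \<mu> {0..1} = 1"
    using assms by (subst prob_space.prob_eq_1) auto
  then show ?thesis using assms by (simp add: unit_law_def)
qed

section \<open>Integrals against sums of independent samples\<close>

text \<open>The recursion sees its inputs only through their sum. Keeping just the test function of
  that sum hides the product measure: with \<open>sum_int_Suc\<close>, later arguments become
  inductions on \<open>k\<close>. Values in \<open>ennreal\<close> avoid integrability
  conditions.\<close>

definition sum_int :: "real measure \<Rightarrow> nat \<Rightarrow> (real \<Rightarrow> ennreal) \<Rightarrow> ennreal" where
  "sum_int \<mu> k h = (\<integral>\<^sup>+X. h (\<Sum>i<k. X i) \<partial>PiM {..<k} (\<lambda>_. \<mu>))"

lemma measurable_component_sum: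
  assumes "sets \<mu> = sets borel"
  shows "(\<lambda>X. \<Sum>i<k. X i :: real) \<in> borel_measurable (PiM {..<k} (\<lambda>_. \<mu>))"
proof -
  have "(\<lambda>X. X i) \<in> borel_measurable (PiM {..<k} (\<lambda>_. \<mu>))" if "i \<in> {..<k}" for i
    using measurable_component_singleton[OF that, of "\<lambda>_. \<mu>"] assms
    by (simp cong: measurable_cong_sets)
  then show ?thesis by (intro borel_measurable_sum) auto
qed

lemma sum_int_0: "prob_space \<mu> \<Longrightarrow> sum_int \<mu> 0 h = h 0"
  unfolding sum_int_def by (simp add: PiM_empty nn_integral_count_space_finite)

lemma measurable_sum_int:
  assumes \<mu>: "unit_law \<mu>"
    and h: "(\<lambda>(y, s). h y s) \<in> borel_measurable (N \<Otimes>\<^sub>M borel)"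
  shows "(\<lambda>y. sum_int \<mu> k (h y)) \<in> borel_measurable N"
proof -
  interpret prob_space \<mu> using unit_lawD[OF \<mu>] by simp
  interpret P: prob_space "PiM {..<k} (\<lambda>_. \<mu>)"
    by (intro prob_space_PiM prob_space_axioms)
  note [measurable] = measurable_component_sum[OF unit_lawD(2)[OF \<mu>]] h
  have "(\<lambda>(y, X). (\<lambda>(y, s). h y s) (y, \<Sum>i<k. X i)) \<in> borel_measurable (N \<Otimes>\<^sub>M PiM {..<k} (\<lambda>_. \<mu>))"
    by measurable
  then have "(\<lambda>(y, X). h y (\<Sum>i<k. X i)) \<in> borel_measurable (N \<Otimes>\<^sub>M PiM {..<k} (\<lambda>_. \<mu>))"
    by simp
  then show ?thesis
    unfolding sum_int_def by (rule P.borel_measurable_nn_integral)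
qed

lemma measurable_sum_int_shift:
  assumes "unit_law \<mu>" "h \<in> borel_measurable borel"
  shows "(\<lambda>y. sum_int \<mu> k (\<lambda>s. h (y + s))) \<in> borel_measurable borel"
proof -
  note [measurable] = assms(2)
  show ?thesis by (rule measurable_sum_int[OF assms(1)]) measurable
qed

lemma sum_int_Suc:
  assumes \<mu>: "unit_law \<mu>" and h: "h \<in> borel_measurable borel"
  shows "sum_int \<mu> (Suc k) h = (\<integral>\<^sup>+y. sum_int \<mu> k (\<lambda>s. h (y + s)) \<partial>\<mu>)"
proof -
  interpret prob_space \<mu> using unit_lawD[OF \<mu>] by simp
  interpret product_sigma_finite "\<lambda>_::nat. \<mu>" ..
  have m: "(\<lambda>X. h (\<Sum>i<Suc k. X i)) \<in> borel_measurable (PiM {..<Suc k} (\<lambda>_. \<mu>))"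
    by (rule measurable_compose[OF measurable_component_sum[OF unit_lawD(2)[OF \<mu>]] h])
  have "sum_int \<mu> (Suc k) h
      = (\<integral>\<^sup>+y. (\<integral>\<^sup>+X. h (\<Sum>i<Suc k. (X(k := y)) i) \<partial>PiM {..<k} (\<lambda>_. \<mu>)) \<partial>\<mu>)"
    unfolding sum_int_def using product_nn_integral_insert_rev[of "{..<k}" k] m
    by (simp add: lessThan_Suc[symmetric])
  also have "\<dots> = (\<integral>\<^sup>+y. sum_int \<mu> k (\<lambda>s. h (y + s)) \<partial>\<mu>)"
    unfolding sum_int_def by (simp add: add.commute)
  finally show ?thesis .
qed

text \<open>A sum of \<open>k\<close> samples from a law on the unit interval lies in the interval
  from 0 to \<open>k\<close>, so comparing the integrands there is enough.\<close>

lemma sum_int_mono: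
  assumes \<mu>: "unit_law \<mu>" and "h \<in> borel_measurable borel" "h' \<in> borel_measurable borel"
    and "\<And>s. 0 \<le> s \<Longrightarrow> s \<le> real k \<Longrightarrow> h s \<le> h' s"
  shows "sum_int \<mu> k h \<le> sum_int \<mu> k h'"
  using assms(2-)
proof (induction k arbitrary: h h')
  case 0
  then show ?case using unit_lawD(1)[OF \<mu>] by (simp add: sum_int_0)
next
  case (Suc k)
  note [measurable] = Suc.prems(1,2)
  have "sum_int \<mu> k (\<lambda>s. h (y + s)) \<le> sum_int \<mu> k (\<lambda>s. h' (y + s))" if "0 \<le> y \<and> y \<le> 1" for y
    using that by (intro Suc.IH Suc.prems(3)) auto
  then show ?case
    unfolding sum_int_Suc[OF \<mu> Suc.prems(1)] sum_int_Suc[OF \<mu> Suc.prems(2)]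
    using unit_lawD(4)[OF \<mu>] by (intro nn_integral_mono_AE) auto
qed

lemma sum_int_cong:
  assumes "unit_law \<mu>" "h \<in> borel_measurable borel" "h' \<in> borel_measurable borel"
    and "\<And>s. 0 \<le> s \<Longrightarrow> s \<le> real k \<Longrightarrow> h s = h' s"
  shows "sum_int \<mu> k h = sum_int \<mu> k h'"
  using assms by (intro antisym sum_int_mono) auto

lemma sum_int_add:
  assumes "unit_law \<mu>" "h \<in> borel_measurable borel" "h' \<in> borel_measurable borel"
  shows "sum_int \<mu> k (\<lambda>s. h s + h' s) = sum_int \<mu> k h + sum_int \<mu> k h'"
  unfolding sum_int_def
  by (intro nn_integral_add measurable_compose[OF measurable_component_sum[OF unit_lawD(2)]] assms)

lemma sum_int_cmult:
  assumes "unit_law \<mu>" "h \<in> borel_measurable borel"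
  shows "sum_int \<mu> k (\<lambda>s. c * h s) = c * sum_int \<mu> k h"
  unfolding sum_int_def
  by (intro nn_integral_cmult measurable_compose[OF measurable_component_sum[OF unit_lawD(2)]] assms)

lemma sum_int_1: "unit_law \<mu> \<Longrightarrow> sum_int \<mu> k (\<lambda>s. 1) = 1"
  unfolding sum_int_def
  by (simp add: prob_space.emeasure_space_1[OF prob_space_PiM] unit_lawD)

text \<open>By exchangeability, every summand of \<open>s\<close> contributes equally.\<close>
lemma sum_int_size_bias:
  assumes \<mu>: "unit_law \<mu>" and g: "g \<in> borel_measurable borel"
  shows "sum_int \<mu> (Suc k) (\<lambda>s. ennreal s * g s)
       = of_nat (Suc k) * (\<integral>\<^sup>+y. ennreal y * sum_int \<mu> k (\<lambda>s. g (y + s)) \<partial>\<mu>)"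
  using g
proof (induction k arbitrary: g)
  case 0
  then show ?case using unit_lawD(1)[OF \<mu>] by (simp add: sum_int_Suc[OF \<mu>] sum_int_0)
next
  case (Suc k)
  interpret prob_space \<mu> using unit_lawD[OF \<mu>] by simp
  interpret pair_sigma_finite \<mu> \<mu> ..
  note g[measurable] = Suc.prems
  have sets[measurable_cong]: "sets \<mu> = sets borel" using unit_lawD[OF \<mu>] by simp
  let ?A = "\<integral>\<^sup>+y. ennreal y * sum_int \<mu> (Suc k) (\<lambda>s. g (y + s)) \<partial>\<mu>"
  have [measurable]: "(\<lambda>y. sum_int \<mu> j (\<lambda>s. g (y + s))) \<in> borel_measurable borel" for j
    by (rule measurable_sum_int_shift[OF \<mu> g])
  have [measurable]: "(\<lambda>y. sum_int \<mu> j (\<lambda>s. ennreal s * g (y + s))) \<in> borel_measurable borel" for j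
    by (rule measurable_sum_int[OF \<mu>]) measurable
  have "sum_int \<mu> (Suc (Suc k)) (\<lambda>s. ennreal s * g s)
      = (\<integral>\<^sup>+y. sum_int \<mu> (Suc k) (\<lambda>s. ennreal (y + s) * g (y + s)) \<partial>\<mu>)"
    by (subst sum_int_Suc[OF \<mu>]) simp_all
  also have "\<dots> = (\<integral>\<^sup>+y. ennreal y * sum_int \<mu> (Suc k) (\<lambda>s. g (y + s))
                      + sum_int \<mu> (Suc k) (\<lambda>s. ennreal s * g (y + s)) \<partial>\<mu>)"
  proof (rule nn_integral_cong_AE, rule AE_mp[OF unit_lawD(4)[OF \<mu>]], rule AE_I2, rule impI)
    fix y :: real assume y: "0 \<le> y \<and> y \<le> 1"
    have "sum_int \<mu> (Suc k) (\<lambda>s. ennreal (y + s) * g (y + s))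
        = sum_int \<mu> (Suc k) (\<lambda>s. ennreal y * g (y + s) + ennreal s * g (y + s))"
      using y by (intro sum_int_cong[OF \<mu>]) (simp_all add: ennreal_plus distrib_right)
    then show "sum_int \<mu> (Suc k) (\<lambda>s. ennreal (y + s) * g (y + s))
      = ennreal y * sum_int \<mu> (Suc k) (\<lambda>s. g (y + s))
        + sum_int \<mu> (Suc k) (\<lambda>s. ennreal s * g (y + s))"
      by (simp add: sum_int_add[OF \<mu>] sum_int_cmult[OF \<mu>])
  qed
  also have "\<dots> = ?A + (\<integral>\<^sup>+y. sum_int \<mu> (Suc k) (\<lambda>s. ennreal s * g (y + s)) \<partial>\<mu>)"
    by (rule nn_integral_add) measurable
  also have "(\<integral>\<^sup>+y. sum_int \<mu> (Suc k) (\<lambda>s. ennreal s * g (y + s)) \<partial>\<mu>)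
      = (\<integral>\<^sup>+y. of_nat (Suc k) * (\<integral>\<^sup>+z. ennreal z * sum_int \<mu> k (\<lambda>s. g (y + z + s)) \<partial>\<mu>) \<partial>\<mu>)"
    by (intro nn_integral_cong) (subst Suc.IH, simp_all add: add.assoc)
  also have "\<dots> = of_nat (Suc k) * (\<integral>\<^sup>+y. (\<integral>\<^sup>+z. ennreal z * sum_int \<mu> k (\<lambda>s. g (y + z + s)) \<partial>\<mu>) \<partial>\<mu>)"
    by (rule nn_integral_cmult) measurable
  also have "(\<integral>\<^sup>+y. (\<integral>\<^sup>+z. ennreal z * sum_int \<mu> k (\<lambda>s. g (y + z + s)) \<partial>\<mu>) \<partial>\<mu>)
      = (\<integral>\<^sup>+z. (\<integral>\<^sup>+y. ennreal z * sum_int \<mu> k (\<lambda>s. g (y + z + s)) \<partial>\<mu>) \<partial>\<mu>)"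
    by (rule Fubini') measurable
  also have "\<dots> = (\<integral>\<^sup>+z. ennreal z * (\<integral>\<^sup>+y. sum_int \<mu> k (\<lambda>s. g (y + z + s)) \<partial>\<mu>) \<partial>\<mu>)"
    by (intro nn_integral_cong nn_integral_cmult) measurable
  also have "\<dots> = ?A"
    by (intro nn_integral_cong) (subst sum_int_Suc[OF \<mu>], simp_all add: ac_simps)
  finally show ?case by (simp add: distrib_right)
qed

section \<open>The distributional recursion on test functions\<close>

lemma rde_kernel_in_subprob:
  assumes \<mu>: "unit_law \<mu>"
  shows "distr (PiM {..<k} (\<lambda>_. \<mu>)) borel (\<lambda>X. x\<^sup>2 / (x\<^sup>2 + (\<Sum>i<k. X i))) \<in> space (subprob_algebra borel)"
proof -
  interpret P: prob_space "PiM {..<k} (\<lambda>_. \<mu>)"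
    by (intro prob_space_PiM unit_lawD[OF \<mu>])
  note [measurable] = measurable_component_sum[OF unit_lawD(2)[OF \<mu>]]
  have "prob_space (distr (PiM {..<k} (\<lambda>_. \<mu>)) borel (\<lambda>X. x\<^sup>2 / (x\<^sup>2 + (\<Sum>i<k. X i))))"
    by (intro P.prob_space_distr) measurable
  then show ?thesis by (auto simp: space_subprob_algebra prob_space_imp_subprob_space)
qed

lemma rde_kernel_measurable:
  assumes \<mu>: "unit_law \<mu>"
  shows "(\<lambda>k. distr (PiM {..<k} (\<lambda>_. \<mu>)) borel (\<lambda>X. x\<^sup>2 / (x\<^sup>2 + (\<Sum>i<k. X i))))
         \<in> measurable (measure_pmf D) (subprob_algebra borel)"
  by (auto simp: Pi_iff intro!: rde_kernel_in_subprob \<mu>)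

lemma nn_integral_rde_map:
  assumes \<mu>: "unit_law \<mu>" and h[measurable]: "h \<in> borel_measurable borel"
  shows "(\<integral>\<^sup>+y. h y \<partial>rde_map D x \<mu>) = (\<integral>\<^sup>+k. sum_int \<mu> k (\<lambda>s. h (x\<^sup>2 / (x\<^sup>2 + s))) \<partial>measure_pmf D)"
  unfolding rde_map_def sum_int_def nn_integral_bind[OF h rde_kernel_measurable[OF \<mu>]]
proof (intro nn_integral_cong)
  fix k
  note [measurable] = measurable_component_sum[OF unit_lawD(2)[OF \<mu>]]
  show "(\<integral>\<^sup>+y. h y \<partial>distr (PiM {..<k} (\<lambda>_. \<mu>)) borel (\<lambda>X. x\<^sup>2 / (x\<^sup>2 + (\<Sum>i<k. X i))))
      = (\<integral>\<^sup>+X. h (x\<^sup>2 / (x\<^sup>2 + (\<Sum>i<k. X i))) \<partial>PiM {..<k} (\<lambda>_. \<mu>))"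
    by (rule nn_integral_distr) simp_all
qed

lemma unit_law_rde_map:
  assumes \<mu>: "unit_law \<mu>" and x: "x > 0"
  shows "unit_law (rde_map D x \<mu>)"
proof -
  have s: "sets (rde_map D x \<mu>) = sets borel"
    unfolding rde_map_def by (subst sets_bind[where N=borel]) auto
  have "emeasure (rde_map D x \<mu>) A = (\<integral>\<^sup>+k. sum_int \<mu> k (\<lambda>s. indicator A (x\<^sup>2 / (x\<^sup>2 + s))) \<partial>measure_pmf D)"
    if "A \<in> sets borel" for A
    using nn_integral_rde_map[OF \<mu>, of "indicator A" D x] that s by simp
  moreover have "sum_int \<mu> k (\<lambda>s. indicator A (x\<^sup>2 / (x\<^sup>2 + s))) = 1" if "{0..1} \<subseteq> A" "A \<in> sets borel" for k A
  proof -
    have "sum_int \<mu> k (\<lambda>s. indicator A (x\<^sup>2 / (x\<^sup>2 + s))) = sum_int \<mu> k (\<lambda>s. 1)"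
    proof (rule sum_int_cong[OF \<mu>])
      fix s :: real assume "0 \<le> s"
      then have "x\<^sup>2 / (x\<^sup>2 + s) \<in> {0..1}" using x by (simp add: divide_le_eq_1 add_pos_nonneg)
      then show "indicator A (x\<^sup>2 / (x\<^sup>2 + s)) = (1::ennreal)" using that by auto
    qed (use that in measurable)
    then show ?thesis by (simp add: sum_int_1[OF \<mu>])
  qed
  \<comment> \<open>Used twice: \<open>A = UNIV\<close> gives total mass one, and
    \<open>A = {0..1}\<close> gives the support.\<close>
  ultimately have e: "emeasure (rde_map D x \<mu>) A = 1" if "{0..1} \<subseteq> A" "A \<in> sets borel" for A
    using that by (simp add: measure_pmf.emeasure_space_1)
  have "prob_space (rde_map D x \<mu>)"
    using e[of UNIV] sets_eq_imp_space_eq[OF s] by (intro prob_spaceI) simp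
  then show ?thesis using e[of "{0..1}"] s by (simp add: unit_law_def measure_def)
qed

section \<open>Quantile coupling and stochastic order\<close>

definition unit_interval :: "real measure" where
  "unit_interval = restrict_space lborel {0<..<1}"

text \<open>The generalised inverse of the distribution function. It transports Lebesgue measure on
  the unit interval to \<open>\<mu>\<close> (\<open>distr_quantile\<close>), so all laws are coupled
  on one probability space.\<close>

definition quantile :: "real measure \<Rightarrow> real \<Rightarrow> real" where
  "quantile \<mu> u = Inf {y. u \<le> cdf \<mu> y}"

text \<open>The usual stochastic order: a larger law has the smaller distribution function. Under
  the quantile coupling it becomes pointwise order.\<close>

definition st_le :: "real measure \<Rightarrow> real measure \<Rightarrow> bool" where
  "st_le \<mu> \<nu> \<longleftrightarrow> (\<forall>y. cdf \<nu> y \<le> cdf \<mu> y)"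

lemma prob_space_unit_interval: "prob_space unit_interval"
  unfolding unit_interval_def
  by (auto simp add: emeasure_restrict_space space_restrict_space intro!: prob_spaceI)

lemma space_unit_interval [simp]: "space unit_interval = {0<..<1}"
  by (simp add: unit_interval_def space_restrict_space)

lemma cdf_distribution_unit_law: "unit_law \<mu> \<Longrightarrow> cdf_distribution \<mu>"
  unfolding cdf_distribution_def real_distribution_def real_distribution_axioms_def
  using unit_lawD[of \<mu>] by simp

lemma quantile_measurable:
  assumes "unit_law \<mu>" shows "quantile \<mu> \<in> borel_measurable unit_interval"
proof -
  interpret cdf_distribution \<mu> by (rule cdf_distribution_unit_law[OF assms])
  show ?thesis
    using measurable_CI unfolding quantile_def[abs_def] unit_interval_def
    by (simp cong: measurable_cong_sets sets_restrict_space_cong)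
qed

lemma distr_quantile:
  assumes "unit_law \<mu>" shows "distr unit_interval borel (quantile \<mu>) = \<mu>"
proof -
  interpret cdf_distribution \<mu> by (rule cdf_distribution_unit_law[OF assms])
  show ?thesis using distr_I_eq_M unfolding quantile_def[abs_def] unit_interval_def .
qed

lemma quantile_le_iff:
  assumes "unit_law \<mu>" "u \<in> {0<..<1}"
  shows "quantile \<mu> u \<le> y \<longleftrightarrow> u \<le> cdf \<mu> y"
proof -
  interpret cdf_distribution \<mu> by (rule cdf_distribution_unit_law[OF assms(1)])
  show ?thesis using pseudoinverse[of u y] assms(2) unfolding quantile_def by auto
qed

lemma quantile_bounds:
  assumes \<mu>: "unit_law \<mu>" and u: "u \<in> {0<..<1}"
  shows "0 \<le> quantile \<mu> u" "quantile \<mu> u \<le> 1"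
proof -
  interpret prob_space \<mu> using unit_lawD[OF \<mu>] by simp
  have s: "sets \<mu> = sets borel" using unit_lawD[OF \<mu>] by simp
  have "cdf \<mu> 1 = 1"
    unfolding cdf_def using unit_lawD(4)[OF \<mu>] s by (subst prob_eq_1) auto
  then show "quantile \<mu> u \<le> 1" using quantile_le_iff[OF \<mu> u] u by simp
  show "0 \<le> quantile \<mu> u"
  proof (rule ccontr)
    assume "\<not> ?thesis"
    then obtain y where y: "quantile \<mu> u \<le> y" "y < 0" by (meson linorder_not_le order_refl)
    have "cdf \<mu> y = 0"
      unfolding cdf_def using unit_lawD(4)[OF \<mu>] s y by (subst prob_eq_0) auto
    then show False using quantile_le_iff[OF \<mu> u] u y by auto
  qed
qed

lemma quantile_mono:
  assumes "unit_law \<mu>" "unit_law \<nu>" "st_le \<mu> \<nu>" "u \<in> {0<..<1}"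
  shows "quantile \<mu> u \<le> quantile \<nu> u"
  using quantile_le_iff[OF assms(1,4)] quantile_le_iff[OF assms(2,4)] assms(3)
  unfolding st_le_def by (meson order_refl order_trans)

lemma nn_integral_quantile:
  assumes "unit_law \<mu>" "h \<in> borel_measurable borel"
  shows "(\<integral>\<^sup>+y. h y \<partial>\<mu>) = (\<integral>\<^sup>+u. h (quantile \<mu> u) \<partial>unit_interval)"
  by (subst distr_quantile[OF assms(1), symmetric], rule nn_integral_distr)
     (use quantile_measurable assms in auto)

lemma nn_integral_st_antimono:
  assumes \<mu>: "unit_law \<mu>" and \<nu>: "unit_law \<nu>" and st: "st_le \<mu> \<nu>"
    and h: "h \<in> borel_measurable borel"
    and anti: "\<And>s t. 0 \<le> s \<Longrightarrow> s \<le> t \<Longrightarrow> t \<le> 1 \<Longrightarrow> h t \<le> h s"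
  shows "(\<integral>\<^sup>+y. h y \<partial>\<nu>) \<le> (\<integral>\<^sup>+y. h y \<partial>\<mu>)"
  unfolding nn_integral_quantile[OF \<mu> h] nn_integral_quantile[OF \<nu> h]
  by (intro nn_integral_mono anti)
     (use quantile_bounds[OF \<mu>] quantile_bounds[OF \<nu>] quantile_mono[OF \<mu> \<nu> st] in auto)

text \<open>Replace the samples one at a time: the induction hypothesis exchanges the law of the
  other \<open>k\<close> summands, and \<open>nn_integral_st_antimono\<close> then exchanges the law
  of the one split off.\<close>

lemma sum_int_st_antimono:
  assumes \<mu>: "unit_law \<mu>" and \<nu>: "unit_law \<nu>" and st: "st_le \<mu> \<nu>"
    and "h \<in> borel_measurable borel"
    and "\<And>s t. 0 \<le> s \<Longrightarrow> s \<le> t \<Longrightarrow> t \<le> real k \<Longrightarrow> h t \<le> h s"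
  shows "sum_int \<nu> k h \<le> sum_int \<mu> k h"
  using assms(4-)
proof (induction k arbitrary: h)
  case 0
  then show ?case using unit_lawD(1)[OF \<mu>] unit_lawD(1)[OF \<nu>] by (simp add: sum_int_0)
next
  case (Suc k)
  note [measurable] = Suc.prems(1)
  have "sum_int \<nu> (Suc k) h = (\<integral>\<^sup>+y. sum_int \<nu> k (\<lambda>s. h (y + s)) \<partial>\<nu>)"
    by (rule sum_int_Suc[OF \<nu> Suc.prems(1)])
  also have "\<dots> \<le> (\<integral>\<^sup>+y. sum_int \<mu> k (\<lambda>s. h (y + s)) \<partial>\<nu>)"
  proof (rule nn_integral_mono_AE, rule AE_mp[OF unit_lawD(4)[OF \<nu>]], rule AE_I2, rule impI)
    fix y :: real assume "0 \<le> y \<and> y \<le> 1"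
    then show "sum_int \<nu> k (\<lambda>s. h (y + s)) \<le> sum_int \<mu> k (\<lambda>s. h (y + s))"
      by (intro Suc.IH Suc.prems(2)) auto
  qed
  also have "\<dots> \<le> (\<integral>\<^sup>+y. sum_int \<mu> k (\<lambda>s. h (y + s)) \<partial>\<mu>)"
  proof (rule nn_integral_st_antimono[OF \<mu> \<nu> st measurable_sum_int_shift[OF \<mu> Suc.prems(1)]])
    fix s t :: real assume "0 \<le> s" "s \<le> t" "t \<le> 1"
    then show "sum_int \<mu> k (\<lambda>a. h (t + a)) \<le> sum_int \<mu> k (\<lambda>a. h (s + a))"
      by (intro sum_int_mono[OF \<mu>] Suc.prems(2)) auto
  qed
  also have "\<dots> = sum_int \<mu> (Suc k) h"
    by (rule sum_int_Suc[OF \<mu> Suc.prems(1), symmetric])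
  finally show ?case .
qed

text \<open>The cavity fraction decreases in the sum of its inputs, so the indicator of an upper
  half-line composed with it is antitone and \<open>sum_int_st_antimono\<close> applies. Taking
  complements returns to distribution functions.\<close>

lemma rde_map_antimono:
  assumes \<mu>: "unit_law \<mu>" and \<nu>: "unit_law \<nu>" and st: "st_le \<mu> \<nu>" and x: "x > 0"
  shows "st_le (rde_map D x \<nu>) (rde_map D x \<mu>)"
  unfolding st_le_def
proof
  fix y :: real
  let ?\<mu> = "rde_map D x \<mu>" and ?\<nu> = "rde_map D x \<nu>"
  note u = unit_law_rde_map[OF \<mu> x, of D] unit_law_rde_map[OF \<nu> x, of D]
  interpret m: prob_space ?\<mu> using unit_lawD[OF u(1)] by simp
  interpret n: prob_space ?\<nu> using unit_lawD[OF u(2)] by simp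
  have [simp]: "sets ?\<mu> = sets borel" "sets ?\<nu> = sets borel" "space ?\<mu> = UNIV" "space ?\<nu> = UNIV"
    using unit_lawD[OF u(1)] unit_lawD[OF u(2)] by simp_all
  have "emeasure ?\<nu> {y<..} \<le> emeasure ?\<mu> {y<..}"
    using nn_integral_rde_map[OF \<mu>, of "indicator {y<..}" D x]
      nn_integral_rde_map[OF \<nu>, of "indicator {y<..}" D x]
  proof simp
    show "(\<integral>\<^sup>+ k. sum_int \<nu> k (\<lambda>s. indicator {y<..} (x\<^sup>2 / (x\<^sup>2 + s))) \<partial>measure_pmf D)
        \<le> (\<integral>\<^sup>+ k. sum_int \<mu> k (\<lambda>s. indicator {y<..} (x\<^sup>2 / (x\<^sup>2 + s))) \<partial>measure_pmf D)"
    proof (intro nn_integral_mono sum_int_st_antimono[OF \<mu> \<nu> st])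
      fix s t :: real assume "0 \<le> s" "s \<le> t"
      from cavity_fraction_antimono[OF x this]
      show "indicator {y<..} (x\<^sup>2 / (x\<^sup>2 + t)) \<le> (indicator {y<..} (x\<^sup>2 / (x\<^sup>2 + s)) :: ennreal)"
        by (auto simp: indicator_def)
    qed measurable
  qed
  then have "measure ?\<nu> {y<..} \<le> measure ?\<mu> {y<..}"
    by (simp add: m.emeasure_eq_measure n.emeasure_eq_measure)
  moreover have "measure ?\<mu> {..y} = 1 - measure ?\<mu> {y<..}" "measure ?\<nu> {..y} = 1 - measure ?\<nu> {y<..}"
    using m.prob_compl[of "{y<..}"] n.prob_compl[of "{y<..}"]
    by (simp_all add: Compl_eq_Diff_UNIV[symmetric] not_less)
  ultimately show "cdf ?\<mu> y \<le> cdf ?\<nu> y" by (simp add: cdf_def)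
qed

section \<open>Means as distances between ordered laws\<close>

definition mean_law :: "real measure \<Rightarrow> real" where
  "mean_law \<mu> = (\<integral>y. y \<partial>\<mu>)"

lemma integrable_unit_law:
  assumes "unit_law \<mu>"
  shows "integrable \<mu> (\<lambda>y. y)"
proof -
  interpret prob_space \<mu> using unit_lawD[OF assms] by simp
  have [measurable_cong]: "sets \<mu> = sets borel" using unit_lawD[OF assms] by simp
  show ?thesis
    by (rule integrable_const_bound[of _ 1]) (use unit_lawD(4)[OF assms] in auto)
qed

lemma nn_integral_mean_law:
  assumes "unit_law \<mu>"
  shows "(\<integral>\<^sup>+y. ennreal y \<partial>\<mu>) = ennreal (mean_law \<mu>)"
  unfolding mean_law_def
  by (rule nn_integral_eq_integral[OF integrable_unit_law[OF assms]])
     (use unit_lawD(4)[OF assms] in auto)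

lemma mean_law_bounds:
  assumes "unit_law \<mu>"
  shows "0 \<le> mean_law \<mu>" "mean_law \<mu> \<le> 1"
proof -
  interpret prob_space \<mu> using unit_lawD[OF assms] by simp
  show "0 \<le> mean_law \<mu>" unfolding mean_law_def
    using unit_lawD(4)[OF assms] by (intro integral_nonneg_AE) auto
  have "mean_law \<mu> \<le> (\<integral>y. 1 \<partial>\<mu>)" unfolding mean_law_def
    using unit_lawD(4)[OF assms] integrable_unit_law[OF assms]
    by (intro integral_mono_AE) auto
  then show "mean_law \<mu> \<le> 1" by (simp add: prob_space)
qed

text \<open>For ordered laws the quantile difference has a constant sign, so the Wasserstein
  distance is just the difference of the means. This is why convergence of means suffices later
  on.\<close>

lemma nn_integral_quantile_diff:
  assumes \<mu>: "unit_law \<mu>" and \<nu>: "unit_law \<nu>" and st: "st_le \<mu> \<nu>"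
  shows "(\<integral>\<^sup>+u. ennreal (quantile \<nu> u - quantile \<mu> u) \<partial>unit_interval) = ennreal (mean_law \<nu> - mean_law \<mu>)"
    and "mean_law \<mu> \<le> mean_law \<nu>"
proof -
  interpret prob_space unit_interval by (rule prob_space_unit_interval)
  have i: "integrable unit_interval (quantile \<mu>) \<and> (\<integral>u. quantile \<mu> u \<partial>unit_interval) = mean_law \<mu>"
    if "unit_law \<mu>" for \<mu>
  proof
    show "integrable unit_interval (quantile \<mu>)"
      by (rule integrable_const_bound[of _ 1])
         (use quantile_bounds[OF that] quantile_measurable[OF that] in auto)
    show "(\<integral>u. quantile \<mu> u \<partial>unit_interval) = mean_law \<mu>"
      unfolding mean_law_def
      by (subst (2) distr_quantile[OF that, symmetric])
         (use quantile_measurable[OF that] in \<open>simp add: integral_distr\<close>)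
  qed
  note q = quantile_mono[OF \<mu> \<nu> st]
  show "(\<integral>\<^sup>+u. ennreal (quantile \<nu> u - quantile \<mu> u) \<partial>unit_interval) = ennreal (mean_law \<nu> - mean_law \<mu>)"
    using i[OF \<mu>] i[OF \<nu>] q by (subst nn_integral_eq_integral) auto
  show "mean_law \<mu> \<le> mean_law \<nu>"
    using i[OF \<mu>] i[OF \<nu>] q by (metis integral_mono space_unit_interval)
qed

lemma nn_integral_st_lipschitz:
  assumes \<mu>: "unit_law \<mu>" and \<nu>: "unit_law \<nu>" and st: "st_le \<mu> \<nu>"
    and h[measurable]: "h \<in> borel_measurable borel" and L: "0 \<le> L"
    and lip: "\<And>s t. 0 \<le> s \<Longrightarrow> s \<le> t \<Longrightarrow> t \<le> 1 \<Longrightarrow> h t \<le> h s + ennreal (L * (t - s))"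
  shows "(\<integral>\<^sup>+y. h y \<partial>\<nu>) \<le> (\<integral>\<^sup>+y. h y \<partial>\<mu>) + ennreal (L * (mean_law \<nu> - mean_law \<mu>))"
proof -
  note [measurable] = quantile_measurable[OF \<mu>] quantile_measurable[OF \<nu>]
  note m = nn_integral_quantile_diff[OF \<mu> \<nu> st]
  have "(\<integral>\<^sup>+y. h y \<partial>\<nu>) = (\<integral>\<^sup>+u. h (quantile \<nu> u) \<partial>unit_interval)"
    by (rule nn_integral_quantile[OF \<nu> h])
  also have "\<dots> \<le> (\<integral>\<^sup>+u. h (quantile \<mu> u) + ennreal L * ennreal (quantile \<nu> u - quantile \<mu> u) \<partial>unit_interval)"
    using quantile_bounds[OF \<mu>] quantile_bounds[OF \<nu>] quantile_mono[OF \<mu> \<nu> st] L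
    by (intro nn_integral_mono) (simp add: lip ennreal_mult'[symmetric])
  also have "\<dots> = (\<integral>\<^sup>+u. h (quantile \<mu> u) \<partial>unit_interval)
      + ennreal L * (\<integral>\<^sup>+u. ennreal (quantile \<nu> u - quantile \<mu> u) \<partial>unit_interval)"
    by (subst nn_integral_add) (measurable, simp add: nn_integral_cmult)
  also have "\<dots> = (\<integral>\<^sup>+y. h y \<partial>\<mu>) + ennreal (L * (mean_law \<nu> - mean_law \<mu>))"
    unfolding m(1) using nn_integral_quantile[OF \<mu> h] L by (simp add: ennreal_mult')
  finally show ?thesis .
qed

section \<open>The edge identity of the unimodular tree\<close>

text \<open>On a tree, this is the probability that an edge belongs to the random matching, where
  \<open>a\<close> and \<open>b\<close> are the probabilities that its endpoints are uncovered in
  the two components left after removing the edge.\<close>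

definition edge_kernel :: "real \<Rightarrow> real \<Rightarrow> real \<Rightarrow> ennreal" where
  "edge_kernel x a b = ennreal (a * b / (x\<^sup>2 + a * b))"

definition edge_int :: "real \<Rightarrow> real measure \<Rightarrow> real measure \<Rightarrow> ennreal" where
  "edge_int x \<mu> \<nu> = (\<integral>\<^sup>+a. \<integral>\<^sup>+b. edge_kernel x a b \<partial>\<nu> \<partial>\<mu>)"

lemma measurable_edge_kernel [measurable]:
  "(\<lambda>(a, b). edge_kernel x a b) \<in> borel_measurable (borel \<Otimes>\<^sub>M borel)"
  unfolding edge_kernel_def by measurable

lemma edge_int_commute:
  assumes \<mu>: "unit_law \<mu>" and \<nu>: "unit_law \<nu>"
  shows "edge_int x \<mu> \<nu> = edge_int x \<nu> \<mu>"
proof -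
  interpret m: prob_space \<mu> using unit_lawD[OF \<mu>] by simp
  interpret n: prob_space \<nu> using unit_lawD[OF \<nu>] by simp
  interpret pair_sigma_finite \<nu> \<mu> ..
  have [measurable_cong]: "sets \<mu> = sets borel" "sets \<nu> = sets borel"
    using unit_lawD[OF \<mu>] unit_lawD[OF \<nu>] by simp_all
  have "edge_int x \<mu> \<nu> = (\<integral>\<^sup>+b. \<integral>\<^sup>+a. edge_kernel x a b \<partial>\<mu> \<partial>\<nu>)"
    unfolding edge_int_def by (rule Fubini') measurable
  also have "\<dots> = edge_int x \<nu> \<mu>"
    unfolding edge_int_def edge_kernel_def by (intro nn_integral_cong) (simp add: mult.commute)
  finally show ?thesis .
qed

text \<open>If \<open>b\<close> is itself produced by the recursion from the sum \<open>s\<close>,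
  the kernel equals the share of the summand \<open>a\<close> in
  \<open>(a + s) / (x\<^sup>2 + (a + s))\<close>, the probability of being covered for a vertex
  whose inputs sum to \<open>a + s\<close>.\<close>

lemma edge_kernel_cavity:
  assumes "0 \<le> a" "0 \<le> s" "x > 0"
  shows "edge_kernel x a (x\<^sup>2 / (x\<^sup>2 + s)) = ennreal a * ennreal (1 / (x\<^sup>2 + (a + s)))"
proof -
  have p: "0 < x\<^sup>2 + s" "0 < x\<^sup>2 + (a + s)" "0 < x\<^sup>2" using assms by (simp_all add: add_pos_nonneg)
  have "x\<^sup>2 + a * (x\<^sup>2 / (x\<^sup>2 + s)) = x\<^sup>2 * (x\<^sup>2 + (a + s)) / (x\<^sup>2 + s)"
    using p by (simp add: field_simps)
  then have "a * (x\<^sup>2 / (x\<^sup>2 + s)) / (x\<^sup>2 + a * (x\<^sup>2 / (x\<^sup>2 + s))) = a * (1 / (x\<^sup>2 + (a + s)))"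
    using p by (simp add: divide_simps)
  then show ?thesis
    unfolding edge_kernel_def by (simp only: ennreal_mult'[OF assms(1)])
qed

lemma nn_integral_pmf_nat:
  "(\<integral>\<^sup>+k. f k \<partial>measure_pmf (D :: nat pmf)) = (\<Sum>k. ennreal (pmf D k) * f k)"
  by (simp add: nn_integral_measure_pmf nn_integral_count_space_nat)

text \<open>The mass transport principle of the unimodular tree: the probability that the root is covered
  is the expected number of covered edges at the root, and each edge sees two independent branches,
  one at each end, one of them a generation deeper than the other.\<close>
lemma unimodular_edge_identity:
  assumes uni: "unimodular P \<rho>" and \<mu>: "unit_law \<mu>" and x: "x > 0"
  shows "(\<integral>\<^sup>+y. ennreal (1 - y) \<partial>rde_map P x \<mu>)
       = ennreal (mean_pmf P) * edge_int x \<mu> (rde_map \<rho> x \<mu>)"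
proof -
  let ?m = "ennreal (mean_pmf P)"
  let ?g = "\<lambda>s. ennreal (1 / (x\<^sup>2 + s))"
  let ?F = "\<lambda>k. sum_int \<mu> k (\<lambda>s. ennreal s * ?g s)"
  let ?H = "\<lambda>k a. ennreal a * sum_int \<mu> k (\<lambda>s. ?g (a + s))"
  have mP: "mean_pmf P > 0" and \<rho>: "\<And>k. pmf \<rho> k = real (k + 1) * pmf P (k + 1) / mean_pmf P"
    using uni by (auto simp: unimodular_def)
  have [measurable_cong]: "sets \<mu> = sets borel" using unit_lawD[OF \<mu>] by simp
  have [measurable]: "(\<lambda>a. sum_int \<mu> k (\<lambda>s. ?g (a + s))) \<in> borel_measurable borel" for k
    by (rule measurable_sum_int_shift[OF \<mu>]) measurable
  \<comment> \<open>This is where unimodularity enters: size-biasing \<open>P\<close> and removing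
    the chosen child leaves the degree law \<open>\<rho>\<close>.\<close>
  have weight: "ennreal (pmf P (Suc k)) * of_nat (Suc k) = ?m * ennreal (pmf \<rho> k)" for k
  proof -
    have "pmf P (Suc k) * real (Suc k) = mean_pmf P * pmf \<rho> k"
      using \<rho>[of k] mP by simp
    then show ?thesis
      using mP by (simp add: ennreal_of_nat_eq_real_of_nat ennreal_mult'[symmetric] del: of_nat_Suc)
  qed
  have frac: "1 - x\<^sup>2 / (x\<^sup>2 + s) = s * (1 / (x\<^sup>2 + s))" if "0 \<le> s" for s
    using that x add_pos_nonneg[of "x\<^sup>2" s] by (simp add: field_simps)
  have "(\<integral>\<^sup>+y. ennreal (1 - y) \<partial>rde_map P x \<mu>)
      = (\<integral>\<^sup>+k. sum_int \<mu> k (\<lambda>s. ennreal (1 - x\<^sup>2 / (x\<^sup>2 + s))) \<partial>measure_pmf P)"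
    by (rule nn_integral_rde_map[OF \<mu>]) measurable
  also have "\<dots> = (\<integral>\<^sup>+k. ?F k \<partial>measure_pmf P)"
    by (intro nn_integral_cong sum_int_cong[OF \<mu>]) (simp_all add: frac ennreal_mult' del: times_divide_eq_right)
  also have "\<dots> = (\<Sum>k. ennreal (pmf P k) * ?F k)" by (rule nn_integral_pmf_nat)
  \<comment> \<open>A root without children is never covered, so the term for \<open>k = 0\<close>
    vanishes and the index can be shifted.\<close>
  also have "\<dots> = (\<Sum>k. ennreal (pmf P (Suc k)) * ?F (Suc k))"
    using suminf_offset[of "\<lambda>k. ennreal (pmf P k) * ?F k" 1] unit_lawD(1)[OF \<mu>]
    by (simp add: sum_int_0)
  also have "\<dots> = (\<Sum>k. ?m * (ennreal (pmf \<rho> k) * (\<integral>\<^sup>+a. ?H k a \<partial>\<mu>)))"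
    by (subst sum_int_size_bias[OF \<mu>]) (simp_all add: mult.assoc[symmetric] weight del: of_nat_Suc)
  also have "\<dots> = ?m * (\<Sum>k. ennreal (pmf \<rho> k) * (\<integral>\<^sup>+a. ?H k a \<partial>\<mu>))" by simp
  also have "(\<Sum>k. ennreal (pmf \<rho> k) * (\<integral>\<^sup>+a. ?H k a \<partial>\<mu>)) = (\<Sum>k. \<integral>\<^sup>+a. ennreal (pmf \<rho> k) * ?H k a \<partial>\<mu>)"
    by (simp add: nn_integral_cmult)
  also have "\<dots> = (\<integral>\<^sup>+a. (\<Sum>k. ennreal (pmf \<rho> k) * ?H k a) \<partial>\<mu>)"
    by (rule nn_integral_suminf[symmetric]) measurable
  also have "\<dots> = edge_int x \<mu> (rde_map \<rho> x \<mu>)"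
    unfolding edge_int_def
  proof (rule nn_integral_cong_AE, rule AE_mp[OF unit_lawD(4)[OF \<mu>]], rule AE_I2, rule impI)
    fix a :: real assume a: "0 \<le> a \<and> a \<le> 1"
    have "(\<integral>\<^sup>+b. edge_kernel x a b \<partial>rde_map \<rho> x \<mu>)
        = (\<integral>\<^sup>+k. sum_int \<mu> k (\<lambda>s. edge_kernel x a (x\<^sup>2 / (x\<^sup>2 + s))) \<partial>measure_pmf \<rho>)"
      by (rule nn_integral_rde_map[OF \<mu>]) measurable
    also have "\<dots> = (\<integral>\<^sup>+k. sum_int \<mu> k (\<lambda>s. ennreal a * ?g (a + s)) \<partial>measure_pmf \<rho>)"
      using a x by (intro nn_integral_cong sum_int_cong[OF \<mu>]) (simp_all add: edge_kernel_cavity)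
    also have "\<dots> = (\<Sum>k. ennreal (pmf \<rho> k) * ?H k a)"
      unfolding nn_integral_pmf_nat by (simp add: sum_int_cmult[OF \<mu>])
    finally show "(\<Sum>k. ennreal (pmf \<rho> k) * ?H k a) = (\<integral>\<^sup>+b. edge_kernel x a b \<partial>rde_map \<rho> x \<mu>)" ..
  qed
  finally show ?thesis .
qed

text \<open>The derivative in \<open>b\<close> is
  \<open>a * x\<^sup>2 / (x\<^sup>2 + a * b)\<^sup>2\<close>, which is at most
  \<open>1 / x\<^sup>2\<close> because \<open>a\<close> is at most 1.\<close>

lemma edge_kernel_lipschitz:
  assumes x: "x > 0" and a: "0 \<le> a" "a \<le> 1" and b: "0 \<le> b" "b \<le> b'"
  shows "edge_kernel x a b' \<le> edge_kernel x a b + ennreal (1 / x\<^sup>2 * (b' - b))"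
proof -
  have ab: "0 \<le> a * b" "0 \<le> a * b'" using a b by auto
  have p: "0 < x\<^sup>2" "x\<^sup>2 \<le> x\<^sup>2 + a * b" "x\<^sup>2 \<le> x\<^sup>2 + a * b'" using x ab by auto
  have "a * b' / (x\<^sup>2 + a * b') - a * b / (x\<^sup>2 + a * b)
      = (x\<^sup>2 * (a * (b' - b))) / ((x\<^sup>2 + a * b') * (x\<^sup>2 + a * b))"
    using p(1) add_pos_nonneg[OF p(1) ab(1)] add_pos_nonneg[OF p(1) ab(2)]
    by (simp add: divide_simps) (simp add: algebra_simps)
  also have "\<dots> \<le> (x\<^sup>2 * (1 * (b' - b))) / (x\<^sup>2 * x\<^sup>2)"
    using p a b by (intro frac_le mult_mono mult_left_mono mult_right_mono mult_nonneg_nonneg) auto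
  also have "\<dots> = 1 / x\<^sup>2 * (b' - b)" using p(1) by (simp add: divide_simps)
  finally have "a * b' / (x\<^sup>2 + a * b') \<le> a * b / (x\<^sup>2 + a * b) + 1 / x\<^sup>2 * (b' - b)" by simp
  then have "edge_kernel x a b' \<le> ennreal (a * b / (x\<^sup>2 + a * b) + 1 / x\<^sup>2 * (b' - b))"
    unfolding edge_kernel_def by (rule ennreal_leI)
  also have "\<dots> = edge_kernel x a b + ennreal (1 / x\<^sup>2 * (b' - b))"
    unfolding edge_kernel_def using ab b p by (intro ennreal_plus) auto
  finally show ?thesis .
qed

lemma edge_int_lipschitz:
  assumes \<mu>: "unit_law \<mu>" and \<nu>: "unit_law \<nu>" and \<nu>': "unit_law \<nu>'" and st: "st_le \<nu> \<nu>'" and x: "x > 0"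
  shows "edge_int x \<mu> \<nu>' \<le> edge_int x \<mu> \<nu> + ennreal (1 / x\<^sup>2 * (mean_law \<nu>' - mean_law \<nu>))"
proof -
  interpret m: prob_space \<mu> using unit_lawD[OF \<mu>] by simp
  interpret n: prob_space \<nu> using unit_lawD[OF \<nu>] by simp
  have [measurable_cong]: "sets \<mu> = sets borel" "sets \<nu> = sets borel"
    using unit_lawD[OF \<mu>] unit_lawD[OF \<nu>] by simp_all
  let ?c = "ennreal (1 / x\<^sup>2 * (mean_law \<nu>' - mean_law \<nu>))"
  have "edge_int x \<mu> \<nu>' \<le> (\<integral>\<^sup>+a. (\<integral>\<^sup>+b. edge_kernel x a b \<partial>\<nu>) + ?c \<partial>\<mu>)"
    unfolding edge_int_def
  proof (rule nn_integral_mono_AE, rule AE_mp[OF unit_lawD(4)[OF \<mu>]], rule AE_I2, rule impI)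
    fix a :: real assume "0 \<le> a \<and> a \<le> 1"
    then show "(\<integral>\<^sup>+b. edge_kernel x a b \<partial>\<nu>') \<le> (\<integral>\<^sup>+b. edge_kernel x a b \<partial>\<nu>) + ?c"
      by (intro nn_integral_st_lipschitz[OF \<nu> \<nu>' st] edge_kernel_lipschitz[OF x]) auto
  qed
  also have "\<dots> = edge_int x \<mu> \<nu> + ?c"
    unfolding edge_int_def by (subst nn_integral_add) (simp_all add: m.emeasure_space_1)
  finally show ?thesis .
qed

lemma nn_integral_one_minus:
  assumes "unit_law \<mu>"
  shows "(\<integral>\<^sup>+y. ennreal (1 - y) \<partial>\<mu>) = ennreal (1 - mean_law \<mu>)"
proof -
  interpret prob_space \<mu> using unit_lawD[OF assms] by simp
  have "(\<integral>\<^sup>+y. ennreal (1 - y) \<partial>\<mu>) = ennreal (\<integral>y. 1 - y \<partial>\<mu>)"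
    by (rule nn_integral_eq_integral)
       (use unit_lawD(4)[OF assms] integrable_unit_law[OF assms] in auto)
  then show ?thesis
    using integrable_unit_law[OF assms] by (simp add: mean_law_def prob_space)
qed

text \<open>Write \<nu> for the image of \<mu> and \<kappa> for the image of \<nu>. The edge
  identity expresses the two root means through the pairs (\<mu>, \<nu>) and (\<nu>, \<kappa>). By
  symmetry of the edge integral both share \<nu>, so they differ only in \<mu> against \<kappa>, and
  the Lipschitz bound applies.\<close>

lemma mean_law_two_step:
  assumes uni: "unimodular P \<rho>" and \<mu>: "unit_law \<mu>" and x: "x > 0"
    and st: "st_le (rde_map \<rho> x (rde_map \<rho> x \<mu>)) \<mu>"
  shows "mean_law (rde_map P x (rde_map \<rho> x \<mu>)) - mean_law (rde_map P x \<mu>)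
       \<le> mean_pmf P / x\<^sup>2 * (mean_law \<mu> - mean_law (rde_map \<rho> x (rde_map \<rho> x \<mu>)))"
proof -
  define \<nu> where "\<nu> = rde_map \<rho> x \<mu>"
  define \<kappa> where "\<kappa> = rde_map \<rho> x \<nu>"
  have \<nu>: "unit_law \<nu>" unfolding \<nu>_def by (rule unit_law_rde_map[OF \<mu> x])
  have \<kappa>: "unit_law \<kappa>" unfolding \<kappa>_def by (rule unit_law_rde_map[OF \<nu> x])
  have st': "st_le \<kappa> \<mu>" using st by (simp add: \<nu>_def \<kappa>_def)
  have m: "mean_law \<kappa> \<le> mean_law \<mu>" by (rule nn_integral_quantile_diff[OF \<kappa> \<mu> st'])
  have mP: "mean_pmf P > 0" using uni by (simp add: unimodular_def)
  let ?e = "\<lambda>\<mu>. mean_law (rde_map P x \<mu>)"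
  have "ennreal (1 - ?e \<mu>) = ennreal (mean_pmf P) * edge_int x \<nu> \<mu>"
    using unimodular_edge_identity[OF uni \<mu> x] edge_int_commute[OF \<mu> \<nu>]
      nn_integral_one_minus[OF unit_law_rde_map[OF \<mu> x]] by (simp add: \<nu>_def)
  also have "\<dots> \<le> ennreal (mean_pmf P) * (edge_int x \<nu> \<kappa> + ennreal (1 / x\<^sup>2 * (mean_law \<mu> - mean_law \<kappa>)))"
    by (intro mult_left_mono edge_int_lipschitz[OF \<nu> \<kappa> \<mu> st' x]) simp
  also have "\<dots> = ennreal (1 - ?e \<nu>) + ennreal (mean_pmf P * (1 / x\<^sup>2 * (mean_law \<mu> - mean_law \<kappa>)))"
    using unimodular_edge_identity[OF uni \<nu> x] nn_integral_one_minus[OF unit_law_rde_map[OF \<nu> x]] mP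
    unfolding distrib_left by (subst ennreal_mult') (simp_all add: \<kappa>_def)
  also have "\<dots> = ennreal (1 - ?e \<nu> + mean_pmf P * (1 / x\<^sup>2 * (mean_law \<mu> - mean_law \<kappa>)))"
    using mean_law_bounds[OF unit_law_rde_map[OF \<nu> x]] mP m x by (intro ennreal_plus[symmetric]) auto
  finally have "1 - ?e \<mu> \<le> 1 - ?e \<nu> + mean_pmf P * (1 / x\<^sup>2 * (mean_law \<mu> - mean_law \<kappa>))"
    using mean_law_bounds[OF unit_law_rde_map[OF \<nu> x]] mP m x by (subst (asm) ennreal_le_iff) auto
  then show ?thesis by (simp add: \<nu>_def \<kappa>_def)
qed

lemma sum_int_mean:
  assumes "unit_law \<mu>"
  shows "sum_int \<mu> k ennreal = ennreal (real k * mean_law \<mu>)"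
proof (cases k)
  case 0
  then show ?thesis using unit_lawD(1)[OF assms] by (simp add: sum_int_0)
next
  case (Suc j)
  have "sum_int \<mu> (Suc j) ennreal = of_nat (Suc j) * ennreal (mean_law \<mu>)"
    using sum_int_size_bias[OF assms, of "\<lambda>_. 1" j]
    by (simp add: sum_int_1[OF assms] nn_integral_mean_law[OF assms])
  then show ?thesis
    using Suc by (simp add: ennreal_of_nat_eq_real_of_nat ennreal_mult' del: of_nat_Suc)
qed

text \<open>Up to \<open>k\<close> the fraction falls with slope at least
  \<open>x\<^sup>2 / (x\<^sup>2 + k)\<^sup>2\<close> in absolute value, so it stays antitone after a
  line of that slope is added.\<close>

lemma cavity_fraction_lower_slope:
  assumes "(x::real) > 0" "0 \<le> s" "s \<le> t" "t \<le> k"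
  shows "x\<^sup>2 / (x\<^sup>2 + t) + x\<^sup>2 / (x\<^sup>2 + k)\<^sup>2 * t \<le> x\<^sup>2 / (x\<^sup>2 + s) + x\<^sup>2 / (x\<^sup>2 + k)\<^sup>2 * s"
proof -
  have p: "0 < x\<^sup>2 + s" "0 < x\<^sup>2 + t" "0 < x\<^sup>2 + k" using assms by (auto intro!: add_pos_nonneg)
  have "x\<^sup>2 / (x\<^sup>2 + k)\<^sup>2 * (t - s) = x\<^sup>2 * (t - s) / ((x\<^sup>2 + k) * (x\<^sup>2 + k))"
    by (simp add: power2_eq_square)
  also have "\<dots> \<le> x\<^sup>2 * (t - s) / ((x\<^sup>2 + s) * (x\<^sup>2 + t))"
    using p assms by (intro divide_left_mono mult_mono mult_nonneg_nonneg mult_pos_pos) auto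
  also have "\<dots> = x\<^sup>2 / (x\<^sup>2 + s) - x\<^sup>2 / (x\<^sup>2 + t)"
    using p by (simp add: divide_simps) (simp add: algebra_simps)
  finally show ?thesis unfolding right_diff_distrib by linarith
qed

text \<open>A quantitative form of antitonicity, which turns a small gap after the recursion into a
  small gap before it. Only the single degree \<open>k\<close> is asked for a strict gain; at all
  other degrees plain monotonicity is used.\<close>

lemma mean_law_rde_map_strict:
  assumes \<mu>: "unit_law \<mu>" and \<nu>: "unit_law \<nu>" and st: "st_le \<mu> \<nu>" and x: "x > 0"
  shows "pmf P k * (x\<^sup>2 / (x\<^sup>2 + real k)\<^sup>2 * real k) * (mean_law \<nu> - mean_law \<mu>)
       \<le> mean_law (rde_map P x \<mu>) - mean_law (rde_map P x \<nu>)"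
proof -
  define c where "c = x\<^sup>2 / (x\<^sup>2 + real k)\<^sup>2"
  have c: "c \<ge> 0" by (simp add: c_def)
  let ?h = "\<lambda>s. ennreal (x\<^sup>2 / (x\<^sup>2 + s))"
  let ?e = "\<lambda>\<mu>. ennreal (c * (real k * mean_law \<mu>))"
  note mb = mean_law_bounds[OF \<mu>] mean_law_bounds[OF \<nu>]
    mean_law_bounds[OF unit_law_rde_map[OF \<mu> x]] mean_law_bounds[OF unit_law_rde_map[OF \<nu> x]]
  have sk: "sum_int \<mu> k (\<lambda>s. ?h s + ennreal c * ennreal s) = sum_int \<mu> k ?h + ?e \<mu>"
    if "unit_law \<mu>" for \<mu>
    using c by (simp add: sum_int_add[OF that] sum_int_cmult[OF that] sum_int_mean[OF that] ennreal_mult')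
  have le_k: "sum_int \<nu> k ?h + ?e \<nu> \<le> sum_int \<mu> k ?h + ?e \<mu>"
    unfolding sk[OF \<mu>, symmetric] sk[OF \<nu>, symmetric]
  proof (rule sum_int_st_antimono[OF \<mu> \<nu> st])
    fix s t :: real assume st: "0 \<le> s" "s \<le> t" "t \<le> real k"
    have "ennreal (x\<^sup>2 / (x\<^sup>2 + t) + c * t) \<le> ennreal (x\<^sup>2 / (x\<^sup>2 + s) + c * s)"
      unfolding c_def by (intro ennreal_leI cavity_fraction_lower_slope[OF x] st)
    then show "?h t + ennreal c * ennreal t \<le> ?h s + ennreal c * ennreal s"
      using st c by (simp add: ennreal_plus ennreal_mult')
  qed measurable
  have le: "sum_int \<nu> j ?h \<le> sum_int \<mu> j ?h" for j
  proof (rule sum_int_st_antimono[OF \<mu> \<nu> st])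
    fix s t :: real assume "0 \<le> s" "s \<le> t"
    then show "?h t \<le> ?h s" by (intro ennreal_leI cavity_fraction_antimono[OF x])
  qed measurable
  have int: "(\<integral>\<^sup>+j. sum_int \<mu> j ?h + ?e \<mu> * indicator {k} j \<partial>measure_pmf P)
      = ennreal (mean_law (rde_map P x \<mu>) + c * (real k * mean_law \<mu>) * pmf P k)" if "unit_law \<mu>" for \<mu>
  proof -
    have "(\<integral>\<^sup>+j. sum_int \<mu> j ?h + ?e \<mu> * indicator {k} j \<partial>measure_pmf P)
        = (\<integral>\<^sup>+j. sum_int \<mu> j ?h \<partial>measure_pmf P) + ?e \<mu> * ennreal (pmf P k)"
      by (subst nn_integral_add) (simp_all add: nn_integral_cmult_indicator emeasure_pmf_single)
    also have "(\<integral>\<^sup>+j. sum_int \<mu> j ?h \<partial>measure_pmf P) = ennreal (mean_law (rde_map P x \<mu>))"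
      using nn_integral_rde_map[OF that, of ennreal P x]
        nn_integral_mean_law[OF unit_law_rde_map[OF that x]] by simp
    finally show ?thesis
      using c mean_law_bounds[OF that] mean_law_bounds[OF unit_law_rde_map[OF that x]]
      by (simp add: ennreal_plus ennreal_mult)
  qed
  have "(\<integral>\<^sup>+j. sum_int \<nu> j ?h + ?e \<nu> * indicator {k} j \<partial>measure_pmf P)
      \<le> (\<integral>\<^sup>+j. sum_int \<mu> j ?h + ?e \<mu> * indicator {k} j \<partial>measure_pmf P)"
    using le le_k by (intro nn_integral_mono) (auto simp: indicator_def)
  then have "mean_law (rde_map P x \<nu>) + c * (real k * mean_law \<nu>) * pmf P k
      \<le> mean_law (rde_map P x \<mu>) + c * (real k * mean_law \<mu>) * pmf P k"
    unfolding int[OF \<mu>] int[OF \<nu>] using c mb by (subst (asm) ennreal_le_iff) auto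
  then show ?thesis unfolding c_def[symmetric] by (simp add: algebra_simps)
qed

section \<open>The fixed point of the distributional recursion\<close>

lemma cdf_unit_law_ge_1:
  assumes \<mu>: "unit_law \<mu>" and "1 \<le> y"
  shows "cdf \<mu> y = 1"
proof -
  interpret prob_space \<mu> using unit_lawD[OF \<mu>] by simp
  have "AE z in \<mu>. z \<in> {..y}" using unit_lawD(4)[OF \<mu>] by eventually_elim (use assms in auto)
  then show ?thesis
    unfolding cdf_def using unit_lawD(2)[OF \<mu>] by (subst prob_eq_1) auto
qed

lemma unit_law_return_1: "unit_law (return borel 1)"
  by (intro unit_lawI_AE prob_space_return) (auto simp: AE_return)

lemma st_le_return_1:
  assumes "unit_law \<mu>" shows "st_le \<mu> (return borel 1)"
  unfolding st_le_def
proof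
  fix y :: real
  show "cdf (return borel 1) y \<le> cdf \<mu> y"
    using cdf_unit_law_ge_1[OF assms, of y]
    by (cases "1 \<le> y") (simp_all add: cdf_def measure_return indicator_def)
qed

section \<open>Iterates from the largest law and the squeeze\<close>

fun cavity_law :: "nat pmf \<Rightarrow> real \<Rightarrow> nat \<Rightarrow> real measure" where
  "cavity_law \<rho> x 0 = return borel 1"
| "cavity_law \<rho> x (Suc r) = rde_map \<rho> x (cavity_law \<rho> x r)"

lemma unit_law_cavity_law: "x > 0 \<Longrightarrow> unit_law (cavity_law \<rho> x r)"
  by (induction r) (auto intro: unit_law_return_1 unit_law_rde_map)

text \<open>The iteration starts at the largest law on the unit interval, so every iterate lies
  below it. Each application of the antitone map reverses this comparison: even iterates dominate
  all later ones, odd iterates are dominated by them.\<close>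

lemma cavity_law_alternating:
  assumes x: "x > 0"
  shows "if even r then st_le (cavity_law \<rho> x (r + d)) (cavity_law \<rho> x r)
         else st_le (cavity_law \<rho> x r) (cavity_law \<rho> x (r + d))"
proof (induction r)
  case 0
  then show ?case using st_le_return_1[OF unit_law_cavity_law[OF x]] by simp
next
  case (Suc r)
  then show ?case
    using rde_map_antimono[OF unit_law_cavity_law[OF x] unit_law_cavity_law[OF x] _ x, of \<rho>]
    by (auto split: if_splits)
qed

lemma cavity_law_odd_even:
  assumes x: "x > 0"
  shows "st_le (cavity_law \<rho> x (Suc (2 * r))) (cavity_law \<rho> x (2 * s))"
proof (cases "s \<le> r")
  case True
  then show ?thesis
    using cavity_law_alternating[OF x, of "2 * s" \<rho> "Suc (2 * r) - 2 * s"] by simp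
next
  case False
  then show ?thesis
    using cavity_law_alternating[OF x, of "Suc (2 * r)" \<rho> "2 * s - Suc (2 * r)"] by simp
qed

lemma rde_solution_iff: "rde_solution \<rho> x \<mu> \<longleftrightarrow> unit_law \<mu> \<and> rde_map \<rho> x \<mu> = \<mu>"
  by (auto simp: rde_solution_def unit_law_def)

lemma rde_solution_alternating:
  assumes x: "x > 0" and \<mu>: "unit_law \<mu>" "rde_map \<rho> x \<mu> = \<mu>"
  shows "if even r then st_le \<mu> (cavity_law \<rho> x r) else st_le (cavity_law \<rho> x r) \<mu>"
proof (induction r)
  case 0
  then show ?case using st_le_return_1[OF \<mu>(1)] by simp
next
  case (Suc r)
  then show ?case
    using rde_map_antimono[OF unit_law_cavity_law[OF x] \<mu>(1) _ x, of \<rho> r \<rho>]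
      rde_map_antimono[OF \<mu>(1) unit_law_cavity_law[OF x] _ x, of \<rho> r \<rho>] \<mu>(2)
    by (auto split: if_splits)
qed

text \<open>In the quantile coupling both quantile functions are trapped between those of
  \<open>a r\<close> and \<open>b r\<close>. The integral of that gap is a difference of means and
  tends to 0, so the quantile functions agree almost everywhere and the laws coincide.\<close>

lemma st_squeeze:
  assumes u: "\<And>r. unit_law (a r)" "\<And>r. unit_law (b r)" and \<mu>: "unit_law \<mu>" and \<nu>: "unit_law \<nu>"
    and st: "\<And>r. st_le (a r) \<mu>" "\<And>r. st_le (a r) \<nu>" "\<And>r. st_le \<mu> (b r)" "\<And>r. st_le \<nu> (b r)"
    and lim: "(\<lambda>r. mean_law (b r) - mean_law (a r)) \<longlonglongrightarrow> 0"
  shows "\<mu> = \<nu>"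
proof -
  note [measurable] = quantile_measurable[OF \<mu>] quantile_measurable[OF \<nu>]
  let ?I = "\<integral>\<^sup>+u. ennreal \<bar>quantile \<mu> u - quantile \<nu> u\<bar> \<partial>unit_interval"
  have "?I \<le> ennreal (mean_law (b r) - mean_law (a r))" for r
  proof -
    have ab: "st_le (a r) (b r)" using st(1,3)[of r] unfolding st_le_def by (meson order_trans)
    have "?I \<le> (\<integral>\<^sup>+u. ennreal (quantile (b r) u - quantile (a r) u) \<partial>unit_interval)"
    proof (intro nn_integral_mono ennreal_leI)
      fix u assume "u \<in> space unit_interval"
      then show "\<bar>quantile \<mu> u - quantile \<nu> u\<bar> \<le> quantile (b r) u - quantile (a r) u"
        using quantile_mono[OF u(1) \<mu> st(1)] quantile_mono[OF u(1) \<nu> st(2)]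
          quantile_mono[OF \<mu> u(2) st(3)] quantile_mono[OF \<nu> u(2) st(4)]
        by (simp add: abs_le_iff) (smt (verit, best))
    qed
    then show ?thesis using nn_integral_quantile_diff(1)[OF u ab] by simp
  qed
  moreover have "(\<lambda>r. ennreal (mean_law (b r) - mean_law (a r))) \<longlonglongrightarrow> ennreal 0"
    by (rule tendsto_ennrealI[OF lim])
  ultimately have "?I \<le> ennreal 0"
    by (intro LIMSEQ_le_const[where X="\<lambda>r. ennreal (mean_law (b r) - mean_law (a r))"]) blast+
  then have "?I = 0" by simp
  then have "AE u in unit_interval. ennreal \<bar>quantile \<mu> u - quantile \<nu> u\<bar> = 0"
    by (subst (asm) nn_integral_0_iff_AE) auto
  then have "AE u in unit_interval. quantile \<mu> u = quantile \<nu> u"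
    by (rule AE_mp) (auto simp: ennreal_eq_0_iff)
  then have "distr unit_interval borel (quantile \<mu>) = distr unit_interval borel (quantile \<nu>)"
    by (intro distr_cong_AE) auto
  then show ?thesis using distr_quantile[OF \<mu>] distr_quantile[OF \<nu>] by simp
qed

lemma st_le_distr:
  assumes "f \<in> borel_measurable unit_interval" "g \<in> borel_measurable unit_interval"
    and "\<And>u. u \<in> {0<..<1} \<Longrightarrow> f u \<le> g u"
  shows "st_le (distr unit_interval borel f) (distr unit_interval borel g)"
  unfolding st_le_def
proof
  fix y
  interpret prob_space unit_interval by (rule prob_space_unit_interval)
  have "measure unit_interval (g -` {..y} \<inter> space unit_interval)
      \<le> measure unit_interval (f -` {..y} \<inter> space unit_interval)"
  proof (rule finite_measure_mono)
    show "f -` {..y} \<inter> space unit_interval \<in> sets unit_interval"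
      by (rule measurable_sets[OF assms(1)]) simp
  qed (use assms(3) in \<open>fastforce intro: order_trans\<close>)
  then show "cdf (distr unit_interval borel g) y \<le> cdf (distr unit_interval borel f) y"
    using assms unfolding cdf_def by (simp add: measure_distr)
qed

section \<open>Convergence of the cavity laws, existence and uniqueness\<close>

context
  fixes P \<rho> :: "nat pmf" and x :: real
  assumes uni: "unimodular P \<rho>" and x: "x > 0"
begin

abbreviation "law \<equiv> cavity_law \<rho> x"
abbreviation "root_mean r \<equiv> mean_law (rde_map P x (law r))"

text \<open>The means of the even iterates decrease and are bounded below, so their consecutive
  differences vanish in the limit. By \<open>mean_law_two_step\<close> these differences control the
  gap between even and odd root means.\<close>

lemma root_mean_gap: "(\<lambda>r. root_mean (Suc (2 * r)) - root_mean (2 * r)) \<longlonglongrightarrow> 0"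
proof -
  note u = unit_law_cavity_law[OF x, of \<rho>]
  let ?m = "\<lambda>r. mean_law (law (2 * r))"
  have st: "st_le (law (Suc (Suc (2 * r)))) (law (2 * r))" for r
    using cavity_law_alternating[OF x, of "2 * r" \<rho> 2] by simp
  have "decseq ?m"
    using nn_integral_quantile_diff(2)[OF u u st] by (intro decseq_SucI) simp
  then obtain l where l: "?m \<longlonglongrightarrow> l"
    by (rule decseq_convergent[of ?m 0]) (use mean_law_bounds[OF u] in auto)
  then have "(\<lambda>r. ?m r - ?m (Suc r)) \<longlonglongrightarrow> l - l"
    by (intro tendsto_diff LIMSEQ_Suc)
  then have lim: "(\<lambda>r. mean_pmf P / x\<^sup>2 * (?m r - ?m (Suc r))) \<longlonglongrightarrow> 0"
    by (intro tendsto_mult_right_zero) simp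
  show ?thesis
  proof (rule tendsto_sandwich[OF _ _ tendsto_const lim]; rule always_eventually; rule allI)
    fix r
    have "st_le (law (Suc (2 * r))) (law (2 * r))" by (rule cavity_law_odd_even[OF x])
    then have "st_le (rde_map P x (law (2 * r))) (rde_map P x (law (Suc (2 * r))))"
      by (rule rde_map_antimono[OF u u _ x])
    then show "0 \<le> root_mean (Suc (2 * r)) - root_mean (2 * r)"
      using nn_integral_quantile_diff(2)[OF unit_law_rde_map[OF u x] unit_law_rde_map[OF u x]]
      unfolding diff_ge_0_iff_ge by blast
    show "root_mean (Suc (2 * r)) - root_mean (2 * r) \<le> mean_pmf P / x\<^sup>2 * (?m r - ?m (Suc r))"
      using mean_law_two_step[OF uni u x, of "2 * r"] st[of r] by simp
  qed
qed

lemma mean_law_gap: "(\<lambda>r. mean_law (law (2 * r)) - mean_law (law (Suc (2 * r)))) \<longlonglongrightarrow> 0"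
proof -
  note u = unit_law_cavity_law[OF x, of \<rho>]
  \<comment> \<open>A positive mean degree supplies a degree \<open>k > 0\<close> of positive
    probability; this makes the constant \<open>c\<close> of the strict estimate positive.\<close>
  have "\<exists>k. real k * pmf P k \<noteq> 0"
  proof (rule ccontr)
    assume "\<nexists>k. real k * pmf P k \<noteq> 0"
    then have "(\<lambda>k. real k * pmf P k) = (\<lambda>_. 0)" by (intro ext) metis
    then have "mean_pmf P = 0" by (simp add: mean_pmf_def)
    then show False using uni by (simp add: unimodular_def)
  qed
  then obtain k where "real k * pmf P k \<noteq> 0" by blast
  then have k: "k > 0" "pmf P k > 0"
    using pmf_nonneg[of P k] by (simp_all add: order_le_less)
  define c where "c = pmf P k * (x\<^sup>2 / (x\<^sup>2 + real k)\<^sup>2 * real k)"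
  have "x\<^sup>2 + real k > 0" using x by (intro add_pos_nonneg) auto
  then have c: "c > 0" unfolding c_def using k x by simp
  have "(\<lambda>r. (root_mean (Suc (2 * r)) - root_mean (2 * r)) / c) \<longlonglongrightarrow> 0 / c"
    by (intro tendsto_divide root_mean_gap tendsto_const) (use c in simp)
  then have lim: "(\<lambda>r. (root_mean (Suc (2 * r)) - root_mean (2 * r)) / c) \<longlonglongrightarrow> 0" by simp
  show ?thesis
  proof (rule tendsto_sandwich[OF _ _ tendsto_const lim]; rule always_eventually; rule allI)
    fix r
    have st: "st_le (law (Suc (2 * r))) (law (2 * r))" by (rule cavity_law_odd_even[OF x])
    show "0 \<le> mean_law (law (2 * r)) - mean_law (law (Suc (2 * r)))"
      using nn_integral_quantile_diff(2)[OF u u st] by simp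
    show "mean_law (law (2 * r)) - mean_law (law (Suc (2 * r)))
        \<le> (root_mean (Suc (2 * r)) - root_mean (2 * r)) / c"
      using mean_law_rde_map_strict[OF u u st x, of P k, folded c_def] c
      by (simp add: pos_le_divide_eq mult.commute)
  qed
qed

lemma rde_solution_unique:
  assumes "rde_solution \<rho> x \<mu>" "rde_solution \<rho> x \<nu>"
  shows "\<mu> = \<nu>"
proof -
  have \<mu>: "unit_law \<mu>" "rde_map \<rho> x \<mu> = \<mu>" and \<nu>: "unit_law \<nu>" "rde_map \<rho> x \<nu> = \<nu>"
    using assms by (simp_all add: rde_solution_iff)
  have *: "st_le (law (Suc (2 * r))) \<kappa> \<and> st_le \<kappa> (law (2 * r))"
    if "unit_law \<kappa>" "rde_map \<rho> x \<kappa> = \<kappa>" for \<kappa> r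
    using rde_solution_alternating[OF x that, of "2 * r"]
      rde_solution_alternating[OF x that, of "Suc (2 * r)"] by simp
  show ?thesis
    by (rule st_squeeze[where a="\<lambda>r. law (Suc (2 * r))" and b="\<lambda>r. law (2 * r)"];
        use \<mu>(1) \<nu>(1) mean_law_gap unit_law_cavity_law[OF x] *[OF \<mu>] *[OF \<nu>] in blast)
qed

lemma rde_solution_exists: "\<exists>\<mu>. rde_solution \<rho> x \<mu>"
proof -
  note u = unit_law_cavity_law[OF x, of \<rho>]
  interpret prob_space unit_interval by (rule prob_space_unit_interval)
  let ?q = "\<lambda>r. quantile (law r)"
  \<comment> \<open>The limit of the even iterates is taken on quantile functions, where it is a
    pointwise infimum and no weak compactness enters.\<close>
  define q where "q v = (INF r. ?q (2 * r) v)" for v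
  define \<mu> where "\<mu> = distr unit_interval borel q"
  note [measurable] = quantile_measurable[OF u]
  have bdd: "bdd_below (range (\<lambda>r. ?q (2 * r) v))" if "v \<in> {0<..<1}" for v
    using quantile_bounds[OF u that] by (auto intro!: bdd_belowI)
  have q[measurable]: "q \<in> borel_measurable unit_interval"
    unfolding q_def[abs_def] by (rule borel_measurable_cINF) (use bdd in auto)
  have upper: "q v \<le> ?q (2 * r) v" if "v \<in> {0<..<1}" for v r
    unfolding q_def by (rule cINF_lower[OF bdd[OF that]]) simp
  have lower: "?q (Suc (2 * r)) v \<le> q v" if "v \<in> {0<..<1}" for v r
    unfolding q_def by (rule cINF_greatest) (use quantile_mono[OF u u cavity_law_odd_even[OF x] that] in auto)
  have \<mu>: "unit_law \<mu>"
  proof (rule unit_lawI_AE)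
    show "prob_space \<mu>" unfolding \<mu>_def by (rule prob_space_distr[OF q])
    have "0 \<le> q v \<and> q v \<le> 1" if "v \<in> {0<..<1}" for v
      using upper[OF that, of 0] lower[OF that, of 0] quantile_bounds[OF u that, of 0]
        quantile_bounds[OF u that, of "Suc 0"] by simp
    then show "AE y in \<mu>. 0 \<le> y \<and> y \<le> 1" unfolding \<mu>_def by (subst AE_distr_iff) auto
  qed (simp add: \<mu>_def)
  have st: "st_le (law (Suc (2 * r))) \<mu>" "st_le \<mu> (law (2 * r))" for r
    using st_le_distr[OF quantile_measurable[OF u] q lower, of r]
      st_le_distr[OF q quantile_measurable[OF u] upper, of r]
    unfolding distr_quantile[OF u] \<mu>_def[symmetric] by blast+
  let ?\<nu> = "rde_map \<rho> x \<mu>"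
  have \<nu>: "unit_law ?\<nu>" by (rule unit_law_rde_map[OF \<mu> x])
  have st': "st_le (law (Suc (2 * r))) ?\<nu>" for r
    using rde_map_antimono[OF \<mu> u st(2) x, of \<rho> r] by simp
  have st'': "st_le ?\<nu> (law (2 * r))" for r
  proof (cases r)
    case 0
    then show ?thesis using st_le_return_1[OF \<nu>] by simp
  next
    case (Suc s)
    then show ?thesis using rde_map_antimono[OF u \<mu> st(1) x, of \<rho> s] by simp
  qed
  \<comment> \<open>The fixed point equation comes without a continuity argument: \<mu> and its
    image lie in the same shrinking brackets.\<close>
  have "\<mu> = ?\<nu>"
    by (rule st_squeeze[where a="\<lambda>r. law (Suc (2 * r))" and b="\<lambda>r. law (2 * r)"];
        use \<mu> \<nu> st st' st'' mean_law_gap u in blast)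
  then show ?thesis using \<mu> by (auto simp: rde_solution_iff)
qed

lemma rde_solution_ex1: "\<exists>!\<mu>. rde_solution \<rho> x \<mu>"
  using rde_solution_exists rde_solution_unique by blast

text \<open>The root applies one more antitone step, so the parities switch: even iterates give
  lower bounds for the root mean, odd ones upper bounds.\<close>

lemma root_mean_limits:
  shows "(\<lambda>r. root_mean (2 * r)) \<longlonglongrightarrow> EY P \<rho> x" "(\<lambda>r. root_mean (Suc (2 * r))) \<longlonglongrightarrow> EY P \<rho> x"
proof -
  note u = unit_law_cavity_law[OF x, of \<rho>]
  define \<mu> where "\<mu> = X_law \<rho> x"
  have "rde_solution \<rho> x \<mu>"
    unfolding \<mu>_def X_law_def by (rule theI'[OF rde_solution_ex1])
  then have \<mu>: "unit_law \<mu>" "rde_map \<rho> x \<mu> = \<mu>" by (simp_all add: rde_solution_iff)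
  have EY: "EY P \<rho> x = mean_law (rde_map P x \<mu>)" by (simp add: EY_def mean_law_def \<mu>_def)
  note mono = nn_integral_quantile_diff(2)[OF unit_law_rde_map[OF _ x] unit_law_rde_map[OF _ x] rde_map_antimono[OF _ _ _ x]]
  have lo: "root_mean (2 * r) \<le> EY P \<rho> x" for r
    unfolding EY using rde_solution_alternating[OF x \<mu>, of "2 * r"] by (intro mono u \<mu>) auto
  have hi: "EY P \<rho> x \<le> root_mean (Suc (2 * r))" for r
    unfolding EY using rde_solution_alternating[OF x \<mu>, of "Suc (2 * r)"] by (intro mono u \<mu>) auto
  have "(\<lambda>r. EY P \<rho> x - root_mean (2 * r)) \<longlonglongrightarrow> 0"
    by (rule tendsto_sandwich[OF _ _ tendsto_const root_mean_gap]) (use lo hi in auto)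
  from tendsto_diff[OF tendsto_const[of "EY P \<rho> x"] this]
  show "(\<lambda>r. root_mean (2 * r)) \<longlonglongrightarrow> EY P \<rho> x" by simp
  from tendsto_add[OF this root_mean_gap]
  show "(\<lambda>r. root_mean (Suc (2 * r))) \<longlonglongrightarrow> EY P \<rho> x" by simp
qed

end

section \<open>The recursion on the Galton-Watson tree\<close>

lemma nn_integral_iid_list:
  fixes p :: "'a pmf" and f :: "'a \<Rightarrow> real"
  assumes "unit_law (distr (measure_pmf p) borel f)" and h: "h \<in> borel_measurable borel"
  shows "(\<integral>\<^sup>+l. h (\<Sum>a\<leftarrow>l. f a) \<partial>measure_pmf (iid_list k p)) = sum_int (distr (measure_pmf p) borel f) k h"
  using h
proof (induction k arbitrary: h)
  case 0
  then show ?case by (simp add: sum_int_0[OF unit_lawD(1)[OF assms(1)]])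
next
  case (Suc k)
  note [measurable] = Suc.prems
  have "(\<integral>\<^sup>+l. h (\<Sum>a\<leftarrow>l. f a) \<partial>measure_pmf (iid_list (Suc k) p))
      = (\<integral>\<^sup>+b. (\<integral>\<^sup>+l. h (f b + (\<Sum>a\<leftarrow>l. f a)) \<partial>measure_pmf (iid_list k p)) \<partial>measure_pmf p)"
    by (simp add: nn_integral_bind_pmf nn_integral_map_pmf)
  also have "\<dots> = (\<integral>\<^sup>+b. sum_int (distr (measure_pmf p) borel f) k (\<lambda>s. h (f b + s)) \<partial>measure_pmf p)"
    by (intro nn_integral_cong Suc.IH) measurable
  also have "\<dots> = sum_int (distr (measure_pmf p) borel f) (Suc k) h"
    unfolding sum_int_Suc[OF assms(1) Suc.prems]
    by (subst nn_integral_distr) (use measurable_sum_int_shift[OF assms(1) Suc.prems] in auto)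
  finally show ?case .
qed

lemma unit_law_tree_cavity:
  assumes "x > 0"
  shows "unit_law (distr (measure_pmf p) borel (tree_cavity x r))"
  by (intro unit_lawI_AE measure_pmf.prob_space_distr)
     (auto simp: AE_distr_iff less_imp_le tree_cavity_bounds[OF assms])

text \<open>The degree law \<open>D\<close> is kept general, so the same step serves
  \<open>\<rho>\<close> at inner vertices and \<open>P\<close> at the root.\<close>

lemma distr_tree_cavity_Suc:
  assumes x: "x > 0"
  shows "distr (measure_pmf (bind_pmf D (\<lambda>k. map_pmf Node (iid_list k p)))) borel (tree_cavity x (Suc r))
       = rde_map D x (distr (measure_pmf p) borel (tree_cavity x r))"
    (is "distr (measure_pmf ?T) borel _ = rde_map D x ?\<mu>")
proof (rule measure_eqI)
  have \<mu>: "unit_law ?\<mu>" by (rule unit_law_tree_cavity[OF x])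
  note s = unit_lawD(2)[OF unit_law_rde_map[OF \<mu> x]]
  show "sets (distr (measure_pmf ?T) borel (tree_cavity x (Suc r))) = sets (rde_map D x ?\<mu>)"
    by (simp add: s)
  fix A assume "A \<in> sets (distr (measure_pmf ?T) borel (tree_cavity x (Suc r)))"
  then have A[measurable]: "A \<in> sets borel" by simp
  have "emeasure (distr (measure_pmf ?T) borel (tree_cavity x (Suc r))) A
      = (\<integral>\<^sup>+y. indicator A y \<partial>distr (measure_pmf ?T) borel (tree_cavity x (Suc r)))"
    by simp
  also have "\<dots> = (\<integral>\<^sup>+t. indicator A (tree_cavity x (Suc r) t) \<partial>measure_pmf ?T)"
    by (rule nn_integral_distr) auto
  also have "\<dots> = (\<integral>\<^sup>+k. (\<integral>\<^sup>+l. indicator A (x\<^sup>2 / (x\<^sup>2 + (\<Sum>c\<leftarrow>l. tree_cavity x r c)))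
                      \<partial>measure_pmf (iid_list k p)) \<partial>measure_pmf D)"
    by (simp add: nn_integral_bind_pmf nn_integral_map_pmf)
  also have "\<dots> = (\<integral>\<^sup>+k. sum_int ?\<mu> k (\<lambda>s. indicator A (x\<^sup>2 / (x\<^sup>2 + s))) \<partial>measure_pmf D)"
    by (intro nn_integral_cong nn_integral_iid_list[OF \<mu>]) measurable
  also have "\<dots> = (\<integral>\<^sup>+y. indicator A y \<partial>rde_map D x ?\<mu>)"
    by (rule nn_integral_rde_map[OF \<mu>, symmetric]) measurable
  also have "\<dots> = emeasure (rde_map D x ?\<mu>) A" using A s by simp
  finally show "emeasure (distr (measure_pmf ?T) borel (tree_cavity x (Suc r))) A = emeasure (rde_map D x ?\<mu>) A" .
qed

lemma distr_gw_desc: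
  assumes x: "x > 0"
  shows "distr (measure_pmf (gw_desc \<rho> r)) borel (tree_cavity x r) = cavity_law \<rho> x r"
proof (induction r)
  case 0
  show ?case by (simp add: return_pmf.rep_eq distr_return)
next
  case (Suc r)
  then show ?case using distr_tree_cavity_Suc[OF x] by simp
qed

lemma expectation_gw_tree:
  assumes x: "x > 0"
  shows "measure_pmf.expectation (gw_tree P \<rho> (Suc r)) (tree_cavity x (Suc r))
       = mean_law (rde_map P x (cavity_law \<rho> x r))"
proof -
  have "mean_law (rde_map P x (cavity_law \<rho> x r))
      = (\<integral>y. y \<partial>distr (measure_pmf (gw_tree P \<rho> (Suc r))) borel (tree_cavity x (Suc r)))"
    unfolding mean_law_def gw_tree.simps distr_tree_cavity_Suc[OF x] distr_gw_desc[OF x] ..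
  then show ?thesis by (simp add: integral_distr)
qed

section \<open>Analyticity\<close>

text \<open>At most one class contains \<open>s\<close>. On that class the correction term is 0;
  outside all classes it is 1, which bounds \<open>f\<close> trivially.\<close>

lemma class_sum_upper:
  fixes f :: real
  assumes "finite R" "disjoint_family_on C R"
    and "\<And>t. t \<in> R \<Longrightarrow> s \<in> C t \<Longrightarrow> f \<le> g t" "f \<le> 1"
  shows "f \<le> (\<Sum>t\<in>R. g t * indicator (C t) s) + (1 - (\<Sum>t\<in>R. indicator (C t) s))"
proof (cases "\<exists>t\<in>R. s \<in> C t")
  case True
  then obtain t where t: "t \<in> R" "s \<in> C t" by blast
  have "s \<notin> C t'" if "t' \<in> R - {t}" for t'
    using assms(2) t that unfolding disjoint_family_on_def by blast
  then have "(\<Sum>t'\<in>R. h t' * indicator (C t') s) = (h t :: real)" for h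
    using t by (subst sum.remove[OF assms(1) t(1)]) simp
  from this[of g] this[of "\<lambda>_. 1"] show ?thesis using assms(3)[OF t] by simp
next
  case False
  then show ?thesis using assms(4) by simp
qed

lemma class_sum_lower:
  fixes f :: real
  assumes "finite R" "disjoint_family_on C R"
    and "\<And>t. t \<in> R \<Longrightarrow> s \<in> C t \<Longrightarrow> g t \<le> f" "0 \<le> f"
  shows "(\<Sum>t\<in>R. g t * indicator (C t) s) \<le> f"
proof (cases "\<exists>t\<in>R. s \<in> C t")
  case True
  then obtain t where t: "t \<in> R" "s \<in> C t" by blast
  have "s \<notin> C t'" if "t' \<in> R - {t}" for t'
    using assms(2) t that unfolding disjoint_family_on_def by blast
  then have "(\<Sum>t'\<in>R. g t' * indicator (C t') s) = g t"
    using t by (subst sum.remove[OF assms(1) t(1)]) simp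
  then show ?thesis using assms(3)[OF t] by simp
next
  case False
  then show ?thesis using assms(4) by simp
qed

lemma expectation_class_bounds:
  fixes p :: "'a pmf" and f :: "'a \<Rightarrow> real"
  assumes R: "finite R" "disjoint_family_on C R"
    and f: "\<And>t s. t \<in> R \<Longrightarrow> s \<in> C t \<Longrightarrow> f s = g t" and b: "\<And>s. 0 \<le> f s" "\<And>s. f s \<le> 1"
  shows "(\<Sum>t\<in>R. g t * measure_pmf.prob p (C t)) \<le> measure_pmf.expectation p f"
    and "measure_pmf.expectation p f
      \<le> (\<Sum>t\<in>R. g t * measure_pmf.prob p (C t)) + (1 - (\<Sum>t\<in>R. measure_pmf.prob p (C t)))"
proof -
  have int: "integrable (measure_pmf p) f"
    by (rule measure_pmf.integrable_const_bound[of _ 1]) (use b in auto)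
  have int': "integrable (measure_pmf p) (\<lambda>s. indicator (C t) s :: real)" for t
    by (rule measure_pmf.integrable_const_bound[of _ 1]) (auto simp: indicator_def)
  have E: "measure_pmf.expectation p (\<lambda>s. \<Sum>t\<in>R. h t * indicator (C t) s)
      = (\<Sum>t\<in>R. h t * measure_pmf.prob p (C t))" for h :: "_ \<Rightarrow> real"
    using int' by (subst Bochner_Integration.integral_sum) auto
  have intE: "integrable (measure_pmf p) (\<lambda>s. \<Sum>t\<in>R. h t * indicator (C t) s)" for h :: "_ \<Rightarrow> real"
    using int' by (intro Bochner_Integration.integrable_sum integrable_mult_right) auto
  note intE1 = intE[of "\<lambda>_. 1", simplified] and E1 = E[of "\<lambda>_. 1", simplified]
  show "(\<Sum>t\<in>R. g t * measure_pmf.prob p (C t)) \<le> measure_pmf.expectation p f"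
    unfolding E[symmetric] using f b
    by (intro integral_mono int intE class_sum_lower[OF R]) auto
  have "measure_pmf.expectation p f \<le> measure_pmf.expectation p
      (\<lambda>s. (\<Sum>t\<in>R. g t * indicator (C t) s) + (1 - (\<Sum>t\<in>R. indicator (C t) s)))"
    using f b intE intE1
    by (intro integral_mono int class_sum_upper[OF R] Bochner_Integration.integrable_add
        Bochner_Integration.integrable_diff) auto
  also have "\<dots> = (\<Sum>t\<in>R. g t * measure_pmf.prob p (C t)) + (1 - (\<Sum>t\<in>R. measure_pmf.prob p (C t)))"
    using intE intE1 E E1 by simp
  finally show "measure_pmf.expectation p f
      \<le> (\<Sum>t\<in>R. g t * measure_pmf.prob p (C t)) + (1 - (\<Sum>t\<in>R. measure_pmf.prob p (C t)))" .
qed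

text \<open>The support is countable; exhaust it by finite initial pieces of an enumeration and use
  continuity from below.\<close>

lemma pmf_finite_approx:
  fixes p :: "'a pmf"
  assumes "e > 0"
  obtains S where "finite S" "S \<subseteq> set_pmf p" "measure_pmf.prob p S > 1 - e"
proof -
  let ?A = "\<lambda>n. from_nat_into (set_pmf p) ` {..n}"
  have "(\<lambda>n. measure_pmf.prob p (?A n)) \<longlonglongrightarrow> measure_pmf.prob p (\<Union>n. ?A n)"
    by (rule measure_pmf.finite_Lim_measure_incseq) (auto simp: incseq_def)
  moreover have "(\<Union>n. ?A n) = set_pmf p"
    using range_from_nat_into[OF set_pmf_not_empty countable_set_pmf, of p] by blast
  moreover have "measure_pmf.prob p (set_pmf p) = 1" by (simp add: measure_pmf.prob_eq_1 AE_measure_pmf)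
  ultimately have "eventually (\<lambda>n. 1 - e < measure_pmf.prob p (?A n)) sequentially"
    using assms by (intro order_tendstoD(1)[of _ 1]) auto
  then obtain n where "1 - e < measure_pmf.prob p (?A n)"
    by (auto simp: eventually_sequentially)
  moreover have "?A n \<subseteq> set_pmf p" using from_nat_into[OF set_pmf_not_empty] by auto
  ultimately show ?thesis by (intro that[of "?A n"]) auto
qed

text \<open>The quotient \<open>tree_cavity z r t / z\<close> at complex activity: this normalisation maps the right
  half plane into itself.\<close>
fun tree_resolvent :: "nat \<Rightarrow> ptree \<Rightarrow> complex \<Rightarrow> complex" where
  "tree_resolvent 0 t z = 1 / z"
| "tree_resolvent (Suc r) (Node cs) z = 1 / (z + (\<Sum>c\<leftarrow>cs. tree_resolvent r c z))"

lemma Re_sum_list: "Re (\<Sum>c\<leftarrow>cs. f c) = (\<Sum>c\<leftarrow>cs. Re (f c))"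
  by (induction cs) auto

lemma of_real_sum_list: "of_real (\<Sum>c\<leftarrow>cs. f c) = (\<Sum>c\<leftarrow>cs. of_real (f c))"
  by (induction cs) auto

lemma tree_resolvent_bounds:
  assumes z: "Re z > 0"
  shows "Re (tree_resolvent r t z) > 0" "norm (tree_resolvent r t z) \<le> 1 / Re z"
proof -
  \<comment> \<open>Branches only add a nonnegative real part, so every denominator \<open>w\<close>
    has real part at least \<open>Re z\<close>. Inversion keeps \<open>w\<close> in the right half
    plane and its modulus is at least \<open>Re w\<close>.\<close>
  have inv: "Re (1 / w) > 0 \<and> norm (1 / w) \<le> 1 / Re z" if "Re z \<le> Re w" for w
  proof -
    have w: "Re w > 0" "w \<noteq> 0" using that z by auto
    then have "Re (1 / w) > 0" by (simp add: Re_divide divide_pos_pos sum_power2_gt_zero_iff)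
    moreover have "Re z \<le> norm w" using that complex_Re_le_cmod[of w] by simp
    then have "norm (1 / w) \<le> 1 / Re z" using z w by (simp add: norm_divide frac_le)
    ultimately show ?thesis ..
  qed
  have "Re (tree_resolvent r t z) > 0 \<and> norm (tree_resolvent r t z) \<le> 1 / Re z"
  proof (induction r arbitrary: t)
    case 0
    show ?case using inv[of z] by simp
  next
    case (Suc r)
    obtain cs where t: "t = Node cs" by (cases t)
    have "0 \<le> (\<Sum>c\<leftarrow>cs. Re (tree_resolvent r c z))"
      using Suc by (intro sum_list_nonneg) (auto intro: less_imp_le)
    then show ?case using inv[of "z + (\<Sum>c\<leftarrow>cs. tree_resolvent r c z)"] by (simp add: t Re_sum_list)
  qed
  then show "Re (tree_resolvent r t z) > 0" "norm (tree_resolvent r t z) \<le> 1 / Re z" by auto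
qed

lemma holomorphic_on_sum_list:
  "(\<And>c. c \<in> set cs \<Longrightarrow> f c holomorphic_on S) \<Longrightarrow> (\<lambda>z. \<Sum>c\<leftarrow>cs. f c z) holomorphic_on S"
  by (induction cs) (auto intro!: holomorphic_intros)

lemma holomorphic_tree_resolvent: "tree_resolvent r t holomorphic_on {z. Re z > 0}"
proof (induction r arbitrary: t)
  case 0
  show ?case by (auto simp: tree_resolvent.simps[abs_def] intro!: holomorphic_intros)
next
  case (Suc r)
  obtain cs where t: "t = Node cs" by (cases t)
  have "z + (\<Sum>c\<leftarrow>cs. tree_resolvent r c z) \<noteq> 0" if z: "Re z > 0" for z
  proof -
    have "0 \<le> Re (\<Sum>c\<leftarrow>cs. tree_resolvent r c z)"
      unfolding Re_sum_list using tree_resolvent_bounds(1)[OF z]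
      by (intro sum_list_nonneg) (auto intro: less_imp_le)
    then have "Re (z + (\<Sum>c\<leftarrow>cs. tree_resolvent r c z)) > 0" using z by simp
    then show ?thesis by (metis less_irrefl zero_complex.sel(1))
  qed
  then show ?case
    unfolding t tree_resolvent.simps[abs_def]
    by (intro holomorphic_intros holomorphic_on_sum_list Suc.IH) auto
qed

lemma tree_resolvent_of_real:
  assumes x: "x > 0"
  shows "of_real x * tree_resolvent r t (of_real x) = of_real (tree_cavity x r t)"
proof (induction r arbitrary: t)
  case 0
  show ?case using x by simp
next
  case (Suc r)
  obtain cs where t: "t = Node cs" by (cases t)
  let ?s = "\<Sum>c\<leftarrow>cs. tree_cavity x r c"
  have "tree_resolvent r c (of_real x) = of_real (tree_cavity x r c / x)" for c
    using Suc[of c] x by (simp add: field_simps)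
  then have "(\<Sum>c\<leftarrow>cs. tree_resolvent r c (of_real x)) = of_real (?s / x)"
    by (simp add: of_real_sum_list[symmetric] divide_inverse sum_list_mult_const[symmetric]
        del: of_real_mult of_real_inverse)
  then have "of_real x * tree_resolvent (Suc r) t (of_real x) = of_real (x * (1 / (x + ?s / x)))"
    by (simp add: t)
  also have "x * (1 / (x + ?s / x)) = x\<^sup>2 / (x\<^sup>2 + ?s)"
    using x by (simp add: field_simps power2_eq_square)
  finally show ?case by (simp add: t)
qed

section \<open>Analyticity of the limit\<close>

text \<open>On the real points the function takes real values, so the real parts of the complex
  Taylor coefficients already form a power series for it.\<close>

lemma real_analytic_on_of_holomorphic:
  assumes S: "open S" and g: "g holomorphic_on S"
    and f: "\<And>x. x \<in> T \<Longrightarrow> of_real x \<in> S" "\<And>x. of_real x \<in> S \<Longrightarrow> g (of_real x) = of_real (f x)"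
  shows "real_analytic_on f T"
  unfolding real_analytic_on_def
proof
  fix x0 assume "x0 \<in> T"
  then obtain r where r: "r > 0" "ball (of_real x0) r \<subseteq> S"
    using f(1) S open_contains_ball by blast
  let ?a = "\<lambda>n. (deriv ^^ n) g (of_real x0) / fact n"
  show "\<exists>r>0. \<exists>a. \<forall>x. \<bar>x - x0\<bar> < r \<longrightarrow> (\<lambda>n. a n * (x - x0) ^ n) sums f x"
  proof (intro exI[of _ r] conjI r(1) exI[of _ "\<lambda>n. Re (?a n)"] allI impI)
    fix x assume x: "\<bar>x - x0\<bar> < r"
    have b: "complex_of_real x \<in> ball (of_real x0) r"
      using x by (simp add: dist_norm norm_of_real_diff abs_minus_commute flip: of_real_diff)
    have "(\<lambda>n. ?a n * (of_real x - of_real x0) ^ n) sums g (of_real x)"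
      by (rule holomorphic_power_series[OF holomorphic_on_subset[OF g r(2)] b])
    then have "(\<lambda>n. Re (?a n * of_real ((x - x0) ^ n))) sums Re (g (of_real x))"
      by (intro sums_Re) simp
    moreover have "Re (?a n * of_real ((x - x0) ^ n)) = Re (?a n) * (x - x0) ^ n" for n
      by (simp only: times_complex.sel Re_complex_of_real Im_complex_of_real mult_zero_right diff_zero)
    moreover have "g (of_real x) = of_real (f x)" using f(2) b r(2) by blast
    ultimately show "(\<lambda>n. Re (?a n) * (x - x0) ^ n) sums f x" by simp
  qed
qed

lemma real_analytic_EY:
  assumes uni: "unimodular P \<rho>"
  shows "real_analytic_on (EY P \<rho>) {0<..}"
proof -
  let ?r = "\<lambda>n. Suc (2 * n)"
  let ?p = "\<lambda>n. gw_tree P \<rho> (?r n)"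
  have "\<exists>S. finite S \<and> measure_pmf.prob (?p n) S > 1 - inverse (real (Suc n))" for n
    by (rule pmf_finite_approx[of "inverse (real (Suc n))" "?p n"]) auto
  then obtain S where S: "\<And>n. finite (S n)" "\<And>n. measure_pmf.prob (?p n) (S n) > 1 - inverse (real (Suc n))"
    by metis
  \<comment> \<open>A holomorphic stand-in for the expectation at odd depth \<open>?r n\<close>.
    Restricting to the finite set \<open>S n\<close> of trees makes it a finite sum, at a cost on
    the positive axis of less than \<open>inverse (real (Suc n))\<close>, as the summands there are
    bounded by 1.\<close>
  define F where "F n z = (\<Sum>t\<in>S n. of_real (pmf (?p n) t) * (z * tree_resolvent (?r n) t z))" for n z
  let ?H = "{z. Re z > 0}"
  have hol: "F n holomorphic_on ?H" for n
    unfolding F_def by (intro holomorphic_intros holomorphic_tree_resolvent)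
  have bound: "norm (F n z) \<le> norm z / Re z" if z: "z \<in> ?H" for n z
  proof -
    have "norm (F n z) \<le> (\<Sum>t\<in>S n. pmf (?p n) t * (norm z * (1 / Re z)))"
      unfolding F_def
    proof (rule order_trans[OF norm_sum], rule sum_mono)
      fix t
      show "norm (of_real (pmf (?p n) t) * (z * tree_resolvent (?r n) t z)) \<le> pmf (?p n) t * (norm z * (1 / Re z))"
        using tree_resolvent_bounds(2)[of z "?r n" t] z
        by (simp only: norm_mult norm_of_real abs_of_nonneg[OF pmf_nonneg])
           (intro mult_left_mono, auto)
    qed
    also have "\<dots> = measure_pmf.prob (?p n) (S n) * (norm z * (1 / Re z))"
      unfolding sum_distrib_right[symmetric] by (simp only: measure_measure_pmf_finite[OF S(1)])
    also have "\<dots> \<le> 1 * (norm z * (1 / Re z))"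
      using z by (intro mult_right_mono) auto
    finally show ?thesis by simp
  qed
  have lim: "(\<lambda>n. F n (of_real x)) \<longlonglongrightarrow> of_real (EY P \<rho> x)" if x: "x > 0" for x
  proof -
    let ?\<phi> = "\<lambda>n. \<Sum>t\<in>S n. tree_cavity x (?r n) t * pmf (?p n) t"
    let ?E = "\<lambda>n. mean_law (rde_map P x (cavity_law \<rho> x (2 * n)))"
    have F: "F n (of_real x) = of_real (?\<phi> n)" for n
      unfolding F_def by (simp add: tree_resolvent_of_real[OF x] mult.commute)
    have "?\<phi> n \<le> ?E n \<and> ?E n \<le> ?\<phi> n + inverse (real (Suc n))" for n
    proof -
      have d: "disjoint_family_on (\<lambda>t. {t}) (S n)" by (auto simp: disjoint_family_on_def)
      note b = expectation_class_bounds[OF S(1) d, where p="?p n" and f="tree_cavity x (?r n)" and g="tree_cavity x (?r n)"]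
      have "?\<phi> n \<le> ?E n" "?E n \<le> ?\<phi> n + (1 - (\<Sum>t\<in>S n. pmf (?p n) t))"
        using b tree_cavity_bounds[OF x] expectation_gw_tree[OF x, of P \<rho> "2 * n"]
        by (auto simp: measure_pmf_single less_imp_le)
      moreover have "(\<Sum>t\<in>S n. pmf (?p n) t) > 1 - inverse (real (Suc n))"
        using S by (metis measure_measure_pmf_finite)
      ultimately show ?thesis by linarith
    qed
    then have "(\<lambda>n. ?E n - ?\<phi> n) \<longlonglongrightarrow> 0"
      by (intro tendsto_sandwich[OF _ _ tendsto_const LIMSEQ_inverse_real_of_nat])
         (auto intro!: always_eventually simp: algebra_simps)
    from tendsto_diff[OF root_mean_limits(1)[OF uni x] this]
    have "?\<phi> \<longlonglongrightarrow> EY P \<rho> x" by simp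
    then show ?thesis unfolding F by (rule tendsto_of_real)
  qed
  have op: "open ?H" by (rule open_halfspace_Re_gt)
  have bdd: "\<exists>B. \<forall>h\<in>range F. \<forall>z\<in>K. norm (h z) \<le> B" if K: "compact K" "K \<subseteq> ?H" for K
  proof -
    have "continuous_on K (\<lambda>z. norm z / Re z)"
      using K(2) by (intro continuous_intros) auto
    then have "bounded ((\<lambda>z. norm z / Re z) ` K)"
      using K(1) compact_continuous_image compact_imp_bounded by blast
    then obtain B where "\<And>z. z \<in> K \<Longrightarrow> norm (norm z / Re z) \<le> B"
      unfolding bounded_iff by blast
    then have "norm (F n z) \<le> B" if "z \<in> K" for n z
      using bound[of z n] that K(2) by (smt (verit) real_norm_def subsetD)
    then show ?thesis by blast
  qed
  \<comment> \<open>Montel's theorem yields only a subsequence. That is enough, because the limit on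
    the positive axis is already known from \<open>lim\<close>.\<close>
  obtain g s where g: "g holomorphic_on ?H" and s: "strict_mono (s :: nat \<Rightarrow> nat)"
    and gl: "\<And>z. z \<in> ?H \<Longrightarrow> (\<lambda>n. F (s n) z) \<longlonglongrightarrow> g z"
  proof (rule Montel[OF op _ bdd order_refl])
    show "h holomorphic_on ?H" if "h \<in> range F" for h using that hol by blast
  next
    fix g s
    assume "g holomorphic_on ?H" "strict_mono (s :: nat \<Rightarrow> nat)"
      "\<And>z. z \<in> ?H \<Longrightarrow> (\<lambda>n. F (s n) z) \<longlonglongrightarrow> g z"
    then show thesis by (rule that)
  qed
  have "g (of_real x) = of_real (EY P \<rho> x)" if "complex_of_real x \<in> ?H" for x
    using LIMSEQ_unique[OF gl[OF that] LIMSEQ_subseq_LIMSEQ[OF lim s, unfolded o_def]] that by simp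
  then show ?thesis
    by (intro real_analytic_on_of_holomorphic[OF op g]) auto
qed

section \<open>Local convergence\<close>

lemma height_Node_le: "(\<And>c. c \<in> set cs \<Longrightarrow> height c \<le> r) \<Longrightarrow> height (Node cs) \<le> Suc r"
  by (induction cs) auto

lemma set_pmf_iid_list: "l \<in> set_pmf (iid_list k p) \<Longrightarrow> c \<in> set l \<Longrightarrow> c \<in> set_pmf p"
  by (induction k arbitrary: l) auto

lemma height_gw_desc: "t \<in> set_pmf (gw_desc \<rho> r) \<Longrightarrow> height t \<le> r"
proof (induction r arbitrary: t)
  case (Suc r)
  then obtain k cs where "cs \<in> set_pmf (iid_list k (gw_desc \<rho> r))" "t = Node cs" by auto
  then show ?case using set_pmf_iid_list Suc.IH by (metis height_Node_le)
qed simp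

lemma height_gw_tree:
  assumes "t \<in> set_pmf (gw_tree P \<rho> r)"
  shows "height t \<le> r"
proof (cases r)
  case (Suc s)
  then obtain k cs where "cs \<in> set_pmf (iid_list k (gw_desc \<rho> s))" "t = Node cs"
    using assms by auto
  then show ?thesis using set_pmf_iid_list height_gw_desc Suc by (metis height_Node_le)
qed (use assms in simp)

text \<open>Local convergence speaks of isomorphism classes, whereas the law \<open>p\<close> lives
  on ordered trees. Choosing one tree per class lets the class probabilities be summed without
  double counting.\<close>

lemma iso_class_approx:
  fixes p :: "ptree pmf"
  assumes "e > 0"
  obtains R where "finite R" "R \<subseteq> set_pmf p" "\<And>s t. s \<in> R \<Longrightarrow> t \<in> R \<Longrightarrow> tree_iso s t \<Longrightarrow> s = t"
    "(\<Sum>t\<in>R. measure_pmf.prob p {s. tree_iso s t}) > 1 - e"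
proof -
  obtain S where S: "finite S" "S \<subseteq> set_pmf p" "measure_pmf.prob p S > 1 - e"
    using pmf_finite_approx[OF assms] .
  \<comment> \<open>The defining predicate depends on \<open>t\<close> only through its isomorphism
    class, so isomorphic trees receive the same representative.\<close>
  define rep where "rep t = (SOME s. s \<in> set_pmf p \<and> tree_iso s t)" for t
  have rep: "rep t \<in> set_pmf p \<and> tree_iso (rep t) t" if "t \<in> S" for t
    unfolding rep_def by (rule someI[of _ t]) (use that S(2) tree_iso_refl in auto)
  have same: "rep s = rep t" if "tree_iso s t" for s t
  proof -
    have "tree_iso a s \<longleftrightarrow> tree_iso a t" for a
      using that rooted_iso_trans tree_iso_sym by meson
    then show ?thesis by (simp add: rep_def)
  qed
  let ?R = "rep ` S"
  have inj: "s = t" if st: "s \<in> ?R" "t \<in> ?R" "tree_iso s t" for s t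
  proof -
    obtain a b where ab: "a \<in> S" "s = rep a" "b \<in> S" "t = rep b" using st by blast
    have "tree_iso a s" "tree_iso t b" using rep ab tree_iso_sym by blast+
    then have "tree_iso a b" using st(3) rooted_iso_trans by meson
    then show ?thesis using same ab by simp
  qed
  have "S \<subseteq> (\<Union>t\<in>?R. {s. tree_iso s t})" using rep tree_iso_sym by fastforce
  then have "measure_pmf.prob p S \<le> measure_pmf.prob p (\<Union>t\<in>?R. {s. tree_iso s t})"
    by (intro measure_pmf.finite_measure_mono) auto
  also have "\<dots> \<le> (\<Sum>t\<in>?R. measure_pmf.prob p {s. tree_iso s t})"
    using S(1) by (intro measure_pmf.finite_measure_subadditive_finite) auto
  finally have "1 - e < (\<Sum>t\<in>?R. measure_pmf.prob p {s. tree_iso s t})" using S(3) by linarith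
  moreover have "?R \<subseteq> set_pmf p" using rep by blast
  ultimately show ?thesis using S(1) inj by (intro that[of ?R]) blast+
qed

section \<open>Vertex averages against tree expectations\<close>

definition view_freq :: "'a graph \<Rightarrow> nat \<Rightarrow> ptree \<Rightarrow> real" where
  "view_freq G r t = real (card {v \<in> verts G. rooted_iso (local_view G v r) v (tree_graph t) []})
                      / real (card (verts G))"

lemma eps_md_class_bounds:
  fixes G :: "'a graph"
  assumes G: "simple_graph G" and x: "x > 0" and R: "finite R"
    and iso: "\<And>s t. s \<in> R \<Longrightarrow> t \<in> R \<Longrightarrow> tree_iso s t \<Longrightarrow> s = t"
  shows "even r \<Longrightarrow> eps_md G x \<le> (\<Sum>t\<in>R. tree_cavity x r t * view_freq G r t)
                                  + (1 - (\<Sum>t\<in>R. view_freq G r t))"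
    and "odd r \<Longrightarrow> (\<Sum>t\<in>R. tree_cavity x r t * view_freq G r t) \<le> eps_md G x"
proof -
  define C where "C t = {v \<in> verts G. rooted_iso (local_view G v r) v (tree_graph t) []}" for t
  let ?V = "verts G" and ?N = "real (card (verts G))"
  have "s = t" if "s \<in> R" "t \<in> R" "v \<in> C s" "v \<in> C t" for s t v
  proof -
    have "rooted_iso (local_view G v r) v (tree_graph s) []" using that by (simp add: C_def)
    then have "rooted_iso (tree_graph s) [] (local_view G v r) v"
      by (rule rooted_iso_sym) (simp add: root_in_rball)
    moreover have "rooted_iso (local_view G v r) v (tree_graph t) []" using that by (simp add: C_def)
    ultimately have "tree_iso s t" by (rule rooted_iso_trans)
    then show ?thesis using iso that by blast
  qed
  then have d: "disjoint_family_on C R" unfolding disjoint_family_on_def by blast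
  have fin: "finite ?V" using simple_graph_finite[OF G] by simp
  have freq: "view_freq G r t = real (card (C t)) / ?N" for t
    by (simp add: view_freq_def C_def)
  have swap: "(\<Sum>v\<in>?V. \<Sum>t\<in>R. h t * indicator (C t) v) = (\<Sum>t\<in>R. h t * real (card (C t)))" for h
  proof -
    have "(\<Sum>v\<in>?V. indicator (C t) v) = real (card (C t))" for t
      using fin by (simp add: indicator_def sum.If_cases C_def Int_def conj_commute cong: conj_cong)
    then show ?thesis by (subst sum.swap) (simp add: sum_distrib_left[symmetric])
  qed
  have swap_div: "(\<Sum>t\<in>R. h t * real (card (C t))) / ?N = (\<Sum>t\<in>R. h t * view_freq G r t)" for h
    by (simp add: freq sum_divide_distrib)
  have R1: "v \<in> C t \<Longrightarrow> if even r then R_md x G v \<le> tree_cavity x r t else tree_cavity x r t \<le> R_md x G v" for v t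
    by (rule R_md_tree_cavity[OF G _ x]) (auto simp: C_def)
  show "eps_md G x \<le> (\<Sum>t\<in>R. tree_cavity x r t * view_freq G r t) + (1 - (\<Sum>t\<in>R. view_freq G r t))"
    if r: "even r"
  proof (cases "?V = {}")
    \<comment> \<open>Without vertices all quotients are divisions by zero, hence 0, and the claim
      reads \<open>0 \<le> 1\<close>.\<close>
    case True
    then show ?thesis by (simp add: eps_md_def view_freq_def)
  next
    case False
    then have N: "?N > 0" using fin by (simp add: card_gt_0_iff)
    have "(\<Sum>v\<in>?V. R_md x G v) \<le> (\<Sum>v\<in>?V. (\<Sum>t\<in>R. tree_cavity x r t * indicator (C t) v)
                                        + (1 - (\<Sum>t\<in>R. 1 * indicator (C t) v)))"
    proof (rule sum_mono)
      fix v
      show "R_md x G v \<le> (\<Sum>t\<in>R. tree_cavity x r t * indicator (C t) v)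
                                        + (1 - (\<Sum>t\<in>R. 1 * indicator (C t) v))"
        unfolding mult_1
        by (rule class_sum_upper[OF R d]) (use R1 r R_md_le_1[OF G x] in auto)
    qed
    also have "\<dots> = (\<Sum>t\<in>R. tree_cavity x r t * real (card (C t))) + (?N - (\<Sum>t\<in>R. 1 * real (card (C t))))"
      by (simp only: sum.distrib sum_subtractf swap) simp
    finally have "eps_md G x \<le> ((\<Sum>t\<in>R. tree_cavity x r t * real (card (C t)))
                    + (?N - (\<Sum>t\<in>R. 1 * real (card (C t))))) / ?N"
      unfolding eps_md_def by (intro divide_right_mono) auto
    also have "\<dots> = (\<Sum>t\<in>R. tree_cavity x r t * view_freq G r t) + (1 - (\<Sum>t\<in>R. 1 * view_freq G r t))"
      unfolding swap_div[symmetric] using N by (simp add: add_divide_distrib diff_divide_distrib)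
    finally show ?thesis by simp
  qed
  show "(\<Sum>t\<in>R. tree_cavity x r t * view_freq G r t) \<le> eps_md G x" if r: "odd r"
    unfolding swap_div[symmetric] eps_md_def swap[symmetric]
  proof (intro divide_right_mono sum_mono)
    fix v
    show "(\<Sum>t\<in>R. tree_cavity x r t * indicator (C t) v) \<le> R_md x G v"
      by (rule class_sum_lower[OF R d]) (use R1 r R_md_nonneg[OF G x] in auto)
  qed simp
qed

text \<open>Choose finitely many classes missing mass less than \<open>e\<close>. The frequency of
  vertices outside them is one minus the frequency inside, so it converges to the missed mass, and
  those vertices change the average by at most that frequency.\<close>

lemma eps_md_tree_expectation:
  fixes G :: "nat \<Rightarrow> 'a graph"
  assumes G: "\<And>n. simple_graph (G n)" and x: "x > 0" and e: "e > 0"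
    and conv: "\<And>t. t \<in> set_pmf p \<Longrightarrow>
                 (\<lambda>n. view_freq (G n) r t) \<longlonglongrightarrow> measure_pmf.prob p {s. tree_iso s t}"
  shows "even r \<Longrightarrow> eventually (\<lambda>n. eps_md (G n) x < measure_pmf.expectation p (tree_cavity x r) + e) sequentially"
    and "odd r \<Longrightarrow> eventually (\<lambda>n. measure_pmf.expectation p (tree_cavity x r) - e < eps_md (G n) x) sequentially"
proof -
  obtain R where R: "finite R" "R \<subseteq> set_pmf p"
    and iso: "\<And>s t. s \<in> R \<Longrightarrow> t \<in> R \<Longrightarrow> tree_iso s t \<Longrightarrow> s = t"
    and mass: "(\<Sum>t\<in>R. measure_pmf.prob p {s. tree_iso s t}) > 1 - e"
    using iso_class_approx[OF e] by metis
  let ?f = "tree_cavity x r" and ?q = "\<lambda>t. measure_pmf.prob p {s. tree_iso s t}"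
  have "s = t" if "s \<in> R" "t \<in> R" "a \<in> {a. tree_iso a s}" "a \<in> {a. tree_iso a t}" for s t a
  proof -
    have "tree_iso s a" "tree_iso a t" using that tree_iso_sym by auto
    then have "tree_iso s t" by (rule rooted_iso_trans)
    then show ?thesis using iso that by blast
  qed
  then have d: "disjoint_family_on (\<lambda>t. {s. tree_iso s t}) R"
    unfolding disjoint_family_on_def by blast
  have E: "(\<Sum>t\<in>R. ?f t * ?q t) \<le> measure_pmf.expectation p ?f"
    "measure_pmf.expectation p ?f \<le> (\<Sum>t\<in>R. ?f t * ?q t) + (1 - (\<Sum>t\<in>R. ?q t))"
    using tree_cavity_bounds[OF x]
    by (intro expectation_class_bounds[OF R(1) d]; auto simp: less_imp_le intro: tree_cavity_iso)+
  have lim: "(\<lambda>n. \<Sum>t\<in>R. h t * view_freq (G n) r t) \<longlonglongrightarrow> (\<Sum>t\<in>R. h t * ?q t)" for h :: "ptree \<Rightarrow> real"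
    using R(2) conv by (intro tendsto_sum tendsto_mult tendsto_const) auto
  note lim1 = lim[of "\<lambda>_. 1", simplified]
  show "eventually (\<lambda>n. eps_md (G n) x < measure_pmf.expectation p ?f + e) sequentially" if r: "even r"
  proof -
    have "eventually (\<lambda>n. (\<Sum>t\<in>R. ?f t * view_freq (G n) r t) + (1 - (\<Sum>t\<in>R. view_freq (G n) r t))
        < measure_pmf.expectation p ?f + e) sequentially"
      by (rule order_tendstoD(2)[OF tendsto_add[OF lim tendsto_diff[OF tendsto_const lim1]]])
         (use E mass in linarith)
    then show ?thesis
      by eventually_elim (rule le_less_trans[OF eps_md_class_bounds(1)[OF G x R(1) iso r]])
  qed
  show "eventually (\<lambda>n. measure_pmf.expectation p ?f - e < eps_md (G n) x) sequentially" if r: "odd r"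
  proof -
    have "eventually (\<lambda>n. measure_pmf.expectation p ?f - e < (\<Sum>t\<in>R. ?f t * view_freq (G n) r t)) sequentially"
      by (rule order_tendstoD(1)[OF lim]) (use E mass in linarith)
    then show ?thesis
      by eventually_elim (erule less_le_trans[OF _ eps_md_class_bounds(2)[OF G x R(1) iso r]])
  qed
qed

lemma eps_md_tendsto_EY:
  fixes G :: "nat \<Rightarrow> 'a graph"
  assumes G: "\<And>n. simple_graph (G n)" and x: "x > 0" and uni: "unimodular P \<rho>"
    and conv: "\<And>r t. t \<in> set_pmf (gw_tree P \<rho> r) \<Longrightarrow>
        (\<lambda>n. view_freq (G n) r t) \<longlonglongrightarrow> measure_pmf.prob (gw_tree P \<rho> r) {s. tree_iso s t}"
  shows "(\<lambda>n. eps_md (G n) x) \<longlonglongrightarrow> EY P \<rho> x"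
proof (rule order_tendstoI)
  fix a assume a: "a < EY P \<rho> x"
  let ?E = "\<lambda>r. mean_law (rde_map P x (cavity_law \<rho> x (2 * r)))"
  obtain r where r: "a < ?E r"
    using order_tendstoD(1)[OF root_mean_limits(1)[OF uni x] a] by (auto simp: eventually_sequentially)
  \<comment> \<open>Depth \<open>Suc (2 * r)\<close> is odd, hence a lower bound, and its
    expectation is the root mean of the iterate with even index \<open>2 * r\<close>: one level is
    spent at the root. The upper bound below uses the next depth.\<close>
  from eps_md_tree_expectation(2)[where r="Suc (2 * r)" and G=G and e="?E r - a", OF G x _ conv] r
  show "eventually (\<lambda>n. a < eps_md (G n) x) sequentially"
    unfolding expectation_gw_tree[OF x] by simp
next
  fix a assume a: "EY P \<rho> x < a"
  let ?E = "\<lambda>r. mean_law (rde_map P x (cavity_law \<rho> x (Suc (2 * r))))"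
  obtain r where r: "?E r < a"
    using order_tendstoD(2)[OF root_mean_limits(2)[OF uni x] a] by (auto simp: eventually_sequentially)
  from eps_md_tree_expectation(1)[where r="Suc (Suc (2 * r))" and G=G and e="a - ?E r", OF G x _ conv] r
  show "eventually (\<lambda>n. eps_md (G n) x < a) sequentially"
    unfolding expectation_gw_tree[OF x] by simp
qed

theorem theorem4p7:
  fixes M :: "'w measure" and G :: "'w \<Rightarrow> nat \<Rightarrow> 'v graph"
    and P \<rho> :: "nat pmf"
  assumes "prob_space M"
    and "\<And>\<omega> n. simple_graph (G \<omega> n)"
    and "unimodular P \<rho>"
    and "summable (\<lambda>k. (real k)\<^sup>2 * pmf P k)"
    and "locally_converges M G P \<rho>"
  shows "(\<forall>x>0. \<exists>!\<mu>. rde_solution \<rho> x \<mu>)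
    \<and> (AE \<omega> in M. \<forall>x>0.
          (\<forall>n. x * deriv (\<lambda>y. ln (Z_md (G \<omega> n) y) / real (card (verts (G \<omega> n)))) x
                 = eps_md (G \<omega> n) x)
        \<and> (\<lambda>n. eps_md (G \<omega> n) x) \<longlonglongrightarrow> EY P \<rho> x)
    \<and> real_analytic_on (EY P \<rho>) {0<..}"
proof (intro conjI allI impI)
  show "\<exists>!\<mu>. rde_solution \<rho> x \<mu>" if "x > 0" for x
    by (rule rde_solution_ex1[OF assms(3) that])
  show "real_analytic_on (EY P \<rho>) {0<..}"
    by (rule real_analytic_EY[OF assms(3)])
  \<comment> \<open>One null set must serve every \<open>x\<close>. The view frequencies do not
    involve \<open>x\<close>, and only countably many pairs of a radius and a tree in the support
    occur, so the exceptional sets can be united first.\<close>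
  have "AE \<omega> in M. \<forall>r. \<forall>t\<in>set_pmf (gw_tree P \<rho> r).
      (\<lambda>n. view_freq (G \<omega> n) r t) \<longlonglongrightarrow> measure_pmf.prob (gw_tree P \<rho> r) {s. tree_iso s t}"
    unfolding AE_all_countable AE_ball_countable[OF countable_set_pmf]
    using assms(5) height_gw_tree unfolding locally_converges_def view_freq_def by blast
  then show "AE \<omega> in M. \<forall>x>0.
          (\<forall>n. x * deriv (\<lambda>y. ln (Z_md (G \<omega> n) y) / real (card (verts (G \<omega> n)))) x
                 = eps_md (G \<omega> n) x)
        \<and> (\<lambda>n. eps_md (G \<omega> n) x) \<longlonglongrightarrow> EY P \<rho> x"
  proof eventually_elim
    case (elim \<omega>)
    show ?case
    proof (intro allI impI conjI)
      fix x :: real assume x: "x > 0"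
      show "x * deriv (\<lambda>y. ln (Z_md (G \<omega> n) y) / real (card (verts (G \<omega> n)))) x = eps_md (G \<omega> n) x" for n
        by (rule deriv_ln_Z_md[OF assms(2) x])
      show "(\<lambda>n. eps_md (G \<omega> n) x) \<longlonglongrightarrow> EY P \<rho> x"
        using elim by (intro eps_md_tendsto_EY[OF assms(2) x assms(3)]) blast
    qed
  qed
qed

end
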